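(* Let $d\ge 2$ and let $\mathbf{K}$ be a compact set of Borel probability measures on $\mathrm{SL}(d,\mathbb{R})$. Assume that (log-moment condition) for every $\mu\in\mathbf{K}$ one has $\int_{\mathrm{SL}(d,\mathbb{R})}\log\|A\|\,d\mu(A)<\infty$; (measures condition) for every $\mu\in\mathbf{K}$ there are no Borel probability measures $\nu_1,\nu_2$ on $\mathbb{RP}^{d-1}$ such that $(f_A)_*\nu_1=\nu_2$ for $\mu$-almost every $A\in\mathrm{SL}(d,\mathbb{R})$. Then there exists $\lambda>0$ such that for any $n\in\mathbb{N}$ and any $\mu_1,\dots,\mu_n\in\mathbf{K}$ one has $$L_n\ge n\lambda .$$ In particular, for any fixed sequence $(\mu_i)_{i\in\mathbb{N}}\in\mathbf{K}^{\mathbb{N}}$ one has $\liminf_{n\to\infty}\frac1nL_n\ge\lambda>0$.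
   Context: Compactness of $\mathbf{K}$ is with respect to the topology of weak-$*$ (weak) convergence of probability measures. $\|A\|$ is the operator norm of $A$ for the Euclidean norm on $\mathbb{R}^d$. For $A\in\mathrm{SL}(d,\mathbb{R})$, $f_A:\mathbb{RP}^{d-1}\to\mathbb{RP}^{d-1}$ is the induced projective transformation. Given $\mu_1,\dots,\mu_n\in\mathbf{K}$, the matrices $A_i$ are chosen independently at random, $A_i$ having distribution $\mu_i$; $T_n=A_nA_{n-1}\cdots A_1$; and $L_n=\mathbb{E}\log\|T_n\|$, the expectation being over $\mu_1\times\dots\times\mu_n$. *)

theory Defs
  imports "HOL-Probability.Probability"
begin

section \<open>Borel probability measures and the topology of weak convergence\<close>

definition borel_of :: "'a topology \<Rightarrow> 'a measure" where
  "borel_of X = sigma (topspace X) {U. openin X U}"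

definition borel_probs :: "'a topology \<Rightarrow> 'a measure set" where
  "borel_probs X = {M. prob_space M \<and> sets M = sets (borel_of X)}"

text \<open>The coarsest topology for which integration against every bounded continuous
  function is continuous.\<close>

definition weak_topology :: "'a topology \<Rightarrow> 'a measure topology" where
  "weak_topology X = topology_generated_by
     {{M \<in> borel_probs X. (\<integral>x. f x \<partial>M) \<in> U} | (f :: 'a \<Rightarrow> real) U.
        continuous_map X euclidean f \<and> bounded (f ` topspace X) \<and> open U}"

lemma space_borel_of: "space (borel_of X) = topspace X"
  unfolding borel_of_def by (rule space_measure_of) (auto dest: openin_subset)

lemma sets_borel_of: "sets (borel_of X) = sigma_sets (topspace X) {U. openin X U}"
  unfolding borel_of_def by (rule sets_measure_of) (auto dest: openin_subset)

lemma sets_borel_of_subtopology: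
  fixes S :: "'a::topological_space set"
  shows "sets (borel_of (top_of_set S)) = sets (restrict_space borel S)"
proof -
  have *: "{U. openin (top_of_set S) U} = (\<lambda>T. S \<inter> T) ` {U. open U}"
    by (auto simp: openin_open)
  have "sets (restrict_space borel S) = {(\<lambda>x. x) -` A \<inter> S | A. A \<in> sigma_sets UNIV {U. open U}}"
    by (auto simp: sets_restrict_space sets_borel)
  also have "\<dots> = sigma_sets S {(\<lambda>x. x) -` A \<inter> S | A. A \<in> {U. open U}}"
    by (rule sigma_sets_vimage_commute) simp
  also have "{(\<lambda>x. x) -` A \<inter> S | A. A \<in> {U. open U}} = (\<lambda>T. S \<inter> T) ` {U. open U}"
    by auto
  finally show ?thesis by (simp add: sets_borel_of *)
qed

lemma topspace_weak_topology: "topspace (weak_topology X) = borel_probs X"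
proof -
  have "borel_probs X \<in>
     {{M \<in> borel_probs X. (\<integral>x. f x \<partial>M) \<in> U} | (f :: 'a \<Rightarrow> real) U.
        continuous_map X euclidean f \<and> bounded (f ` topspace X) \<and> open U}"
    by (rule CollectI, rule exI[of _ "\<lambda>_. 0"], rule exI[of _ UNIV])
       (auto intro: bounded_subset[of "{0}"])
  then show ?thesis
    unfolding weak_topology_def topology_generated_by_topspace by blast
qed

section \<open>The special linear group and its action on projective space\<close>

definition SL :: "(real^'n^'n) set" where
  "SL = {A. det A = 1}"

definition op_norm :: "real^'n^'n \<Rightarrow> real" where
  "op_norm A = onorm (\<lambda>v. A *v v)"

text \<open>Points of the projective space are the lines \<open>span {v}\<close> with \<open>v \<noteq> 0\<close>; the
  topology is the quotient topology with respect to \<open>v \<mapsto> span {v}\<close>.\<close>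

definition proj_lines :: "(real^'n) set set" where
  "proj_lines = {span {v} | v. v \<noteq> 0}"

definition proj_space :: "(real^'n) set topology" where
  "proj_space = topology (\<lambda>U. U \<subseteq> proj_lines \<and> open {v. v \<noteq> 0 \<and> span {v} \<in> U})"

definition proj_map :: "real^'n^'n \<Rightarrow> (real^'n) set \<Rightarrow> (real^'n) set" where
  "proj_map A l = (\<lambda>v. A *v v) ` l"

lemma openin_proj_space:
  fixes U :: "(real^'n) set set"
  shows "openin proj_space U \<longleftrightarrow> U \<subseteq> proj_lines \<and> open {v. v \<noteq> 0 \<and> span {v} \<in> U}"
proof -
  have "istopology (\<lambda>U. U \<subseteq> proj_lines \<and> open {v :: real^'n. v \<noteq> 0 \<and> span {v} \<in> U})"
    unfolding istopology_def
  proof (intro conjI allI impI, goal_cases)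
    case (2 S T)
    have "{v :: real^'n. v \<noteq> 0 \<and> span {v} \<in> S \<inter> T} =
      {v. v \<noteq> 0 \<and> span {v} \<in> S} \<inter> {v. v \<noteq> 0 \<and> span {v} \<in> T}" by auto
    with 2 show ?case by auto
  next
    case (4 K)
    have "{v :: real^'n. v \<noteq> 0 \<and> span {v} \<in> \<Union>K} =
      (\<Union>S\<in>K. {v. v \<noteq> 0 \<and> span {v} \<in> S})" by auto
    with 4 show ?case by auto
  qed auto
  then show ?thesis
    unfolding proj_space_def by (simp add: topology_inverse')
qed

lemma topspace_proj_space: "topspace proj_space = (proj_lines :: (real^'n) set set)"
proof -
  have "{v :: real^'n. v \<noteq> 0 \<and> span {v} \<in> proj_lines} = - {0}"
    by (auto simp: proj_lines_def)
  then have "openin proj_space (proj_lines :: (real^'n) set set)"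
    by (simp add: openin_proj_space open_Compl)
  then show ?thesis
    unfolding topspace_def by (auto simp: openin_proj_space)
qed

lemma quotient_map_proj_space:
  "quotient_map (top_of_set (- {0 :: real^'n})) proj_space (\<lambda>v. span {v})"
proof -
  have "openin (top_of_set (- {0})) {v \<in> - {0}. span {v} \<in> U} \<longleftrightarrow>
      open {v. v \<noteq> 0 \<and> span {v} \<in> U}" for U :: "(real^'n) set set"
  proof -
    have "openin (top_of_set (- {0})) W \<longleftrightarrow> open W" if "W \<subseteq> - {0}" for W :: "(real^'n) set"
      using that by (simp add: openin_open_eq open_Compl)
    then show ?thesis by (simp add: Collect_mono_iff subset_eq)
  qed
  then show ?thesis
    unfolding quotient_map_def
    by (auto simp: topspace_proj_space openin_proj_space proj_lines_def)
qed

lemma proj_lines_eq: "proj_lines = {S :: (real^'n) set. subspace S \<and> dim S = 1}"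
proof safe
  fix S :: "(real^'n) set" assume "S \<in> proj_lines"
  then obtain v where v: "v \<noteq> 0" "S = span {v}" by (auto simp: proj_lines_def)
  show "subspace S" "dim S = 1" using v by (simp_all add: dim_span)
next
  fix S :: "(real^'n) set" assume S: "subspace S" "dim S = 1"
  then obtain B where B: "B \<subseteq> S" "independent B" "S \<subseteq> span B" "card B = 1"
    by (metis basis_exists)
  then obtain v where "B = {v}" by (auto simp: card_1_singleton_iff)
  with B S have "v \<noteq> 0" "S = span {v}"
    using dependent_zero span_minimal[of B S] by auto
  then show "S \<in> proj_lines"
    by (auto simp: proj_lines_def)
qed

lemma proj_map_span: "proj_map A (span {v}) = span {A *v v}"
  unfolding proj_map_def
  using linear_span_image[OF matrix_vector_mul_linear, of A "{v}"] by simp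

lemma continuous_map_proj_map:
  assumes "A \<in> SL"
  shows "continuous_map proj_space proj_space (proj_map A)"
proof -
  have "det A \<noteq> 0"
    using assms by (simp add: SL_def)
  then have "inj ((*v) A)"
    by (simp add: invertible_det_nz[symmetric] inj_matrix_vector_mult)
  then have nz: "A *v v \<noteq> 0" if "v \<noteq> 0" for v
    using that injD[of "(*v) A" v 0] by auto
  have "open {v. v \<noteq> 0 \<and> span {A *v v} \<in> U}" if "openin proj_space U" for U
  proof -
    have "open ((\<lambda>v. A *v v) -` {v. v \<noteq> 0 \<and> span {v} \<in> U})"
      using that by (intro open_vimage)
        (auto simp: openin_proj_space intro!: linear_continuous_on matrix_vector_mul_bounded_linear)
    moreover have "(\<lambda>v. A *v v) -` {v. v \<noteq> 0 \<and> span {v} \<in> U} = {v. v \<noteq> 0 \<and> span {A *v v} \<in> U}"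
      using nz by (fastforce simp: vimage_def)
    ultimately show ?thesis by simp
  qed
  moreover have "{v. v \<noteq> 0 \<and> span {v} \<in> {l \<in> proj_lines. proj_map A l \<in> U}} =
      {v. v \<noteq> 0 \<and> span {A *v v} \<in> U}" for U
    by (auto simp: proj_lines_def proj_map_span)
  ultimately show ?thesis
    using nz unfolding continuous_map_def topspace_proj_space
    by (auto simp: proj_lines_def proj_map_span openin_proj_space Pi_iff)
qed

lemma measurable_proj_map:
  assumes "A \<in> SL"
  shows "proj_map A \<in> borel_of proj_space \<rightarrow>\<^sub>M borel_of proj_space"
  using continuous_map_proj_map[OF assms]
  by (intro measurable_sigma_sets[OF sets_borel_of])
     (auto simp: continuous_map_def space_borel_of sets_borel_of vimage_def Int_def conj_commute
       dest: openin_subset intro!: sigma_sets.Basic)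

section \<open>Random products\<close>

text \<open>The factors are \<open>A 1, A 2, \<dots>\<close>; a new factor is multiplied on the left.\<close>

fun mat_product :: "(nat \<Rightarrow> real^'n^'n) \<Rightarrow> nat \<Rightarrow> real^'n^'n" where
  "mat_product A 0 = mat 1"
| "mat_product A (Suc n) = A (Suc n) ** mat_product A n"

definition expected_log_norm :: "(nat \<Rightarrow> (real^'n^'n) measure) \<Rightarrow> nat \<Rightarrow> real" where
  "expected_log_norm \<mu> n = (\<integral>A. ln (op_norm (mat_product A n)) \<partial>(\<Pi>\<^sub>M i\<in>{1..n}. \<mu> i))"

end

theory Submission
  imports Defs
begin

text \<open>
  The proof follows Virtser's approach to positivity of the top Lyapunov exponent through norms of
  averaged isometries, made uniform in the driving measures.  Write \<open>d\<close> for the dimension.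
  The group \<open>SL\<close> preserves Lebesgue measure on \<open>\<real>\<^sup>d\<close>, so it acts on square integrable functions by the isometries \<open>f \<mapsto> f \<circ> A\<close>, and a
  random matrix with law \<open>\<mu>\<close> gives the averaged operator \<open>transfer \<mu>\<close>, of norm at most one.

  Key point: under the hypothesis on measures this operator has norm at most some \<open>\<rho> < 1\<close>, and one
  \<open>\<rho>\<close> serves all of \<open>K\<close> (\<open>uniform_separation\<close>, \<open>transfer_contracts\<close>).  Suppose that unit vectors
  \<open>f\<close>, \<open>g\<close> have average overlap \<open>\<integral>\<integral> f (A x) g x\<close> close to one.  Then for most \<open>A\<close> the functions
  \<open>f \<circ> A\<close> and \<open>g\<close> nearly agree, so \<open>A\<close> carries the probability density \<open>g\<^sup>2\<close> nearly to \<open>f\<^sup>2\<close>,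
  and projecting radially to the unit sphere \<open>A\<close> carries one probability measure nearly to another.
  By compactness such near misses would accumulate at an exact pair of measures on the
  sphere, hence on projective space, which is excluded.

  The compactness is organized through functionals: a probability measure on the sphere is
  replaced by the functional it induces on continuous functions.  These functionals form a compact
  set in the topology of pointwise convergence (\<open>compact_states\<close>, Tychonoff's theorem), and each of
  them is integration against a probability measure (\<open>state_representation\<close>, the Riesz
  representation theorem).  An integral that measures how far \<open>\<mu>\<close> is from carrying one functional
  to another is positive for some test function (\<open>positive_discrepancy\<close>) and is lower
  semicontinuous (\<open>discrepancy_nbhd\<close>), so finitely many test functions suffice.

  Iterating the contraction bounds the expected overlap of the unit ball with its preimage under
  \<open>T\<^sub>n\<close> by \<open>\<rho>\<^sup>n\<close> times the volume of the ball.  That overlap contains a ball of radius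
  \<open>1 / \<parallel>T\<^sub>n\<parallel>\<close>, so the expectation of \<open>\<parallel>T\<^sub>n\<parallel>\<close> to the power \<open>- d\<close> is at most \<open>\<rho>\<^sup>n\<close>, and
  convexity of the exponential function turns this into
  \<open>d * L\<^sub>n \<ge> - n * ln \<rho>\<close> (\<open>expected_inverse_norm\<close>, \<open>expected_log_norm_lower_bound\<close>).
\<close>


section \<open>Matrices of determinant one preserve Lebesgue measure\<close>

lemma swap_coordinates_scales_measure:
  fixes S :: "(real^'n) set"
  assumes "m \<noteq> n" and "S \<in> lmeasurable"
  defines "f \<equiv> \<lambda>x :: real^'n. \<chi> i. x $ Transposition.transpose m n i"
  shows "f ` S \<in> lmeasurable \<and> measure lebesgue (f ` S) = \<bar>det (matrix f)\<bar> * measure lebesgue S"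
proof -
  let ?t = "Transposition.transpose m n"
  have lin: "linear f"
    unfolding f_def by (rule linearI) (simp_all add: plus_vec_def scaleR_vec_def)
  have "matrix f = (\<chi> i. mat 1 $ ?t i)"
    by (auto simp: matrix_def f_def vec_eq_iff axis_def mat_def)
  moreover have "det (\<chi> i. (mat 1 :: real^'n^'n) $ ?t i) = of_int (sign ?t) * det (mat 1 :: real^'n^'n)"
    by (rule det_permute_rows) (simp add: permutes_swap_id)
  ultimately have det: "\<bar>det (matrix f)\<bar> = 1"
    using assms by (simp add: sign_swap_id abs_mult)
  have "f ` cbox a b = cbox (f a) (f b)" for a b
  proof
    show "cbox (f a) (f b) \<subseteq> f ` cbox a b"
    proof
      fix y assume y: "y \<in> cbox (f a) (f b)"
      have "f (f y) = y" by (simp add: f_def vec_eq_iff)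
      moreover have "f y \<in> cbox a b"
        unfolding mem_box_cart
      proof
        fix i
        show "a $ i \<le> f y $ i \<and> f y $ i \<le> b $ i"
          using y[unfolded mem_box_cart, rule_format, of "?t i"] by (simp add: f_def)
      qed
      ultimately show "y \<in> f ` cbox a b" by (metis imageI)
    qed
  qed (auto simp: f_def mem_box_cart)
  moreover have "measure lebesgue (cbox (f a) (f b)) = measure lebesgue (cbox a b)" for a b
  proof (cases "cbox a b = {}")
    case True
    then have "f ` cbox a b = {}" by simp
    with True show ?thesis unfolding calculation[symmetric] by simp
  next
    case False
    then have "cbox (f a) (f b) \<noteq> {}" using calculation by blast
    with False show ?thesis
      using prod.permute[OF permutes_swap_id, of m UNIV n "\<lambda>i. (b - a) $ i"]
      by (simp add: content_cbox_cart f_def o_def)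
  qed
  ultimately show ?thesis
    using measure_linear_sufficient[OF lin \<open>S \<in> lmeasurable\<close>, of 1] det by simp
qed

text \<open>
  The index type carries no order in which the matrix of the shear would be triangular; its
  determinant is found by viewing it as a row operation on the identity matrix.
\<close>

lemma shear_scales_measure:
  fixes S :: "(real^'n) set"
  assumes "m \<noteq> n" and "S \<in> lmeasurable"
  defines "f \<equiv> \<lambda>x :: real^'n. \<chi> i. if i = m then x $ m + x $ n else x $ i"
  shows "f ` S \<in> lmeasurable \<and> measure lebesgue (f ` S) = \<bar>det (matrix f)\<bar> * measure lebesgue S"
proof -
  have lin: "linear f"
    unfolding f_def
    by (rule linearI) (auto simp: algebra_simps plus_vec_def scaleR_vec_def vec_eq_iff)
  have "matrix f = (\<chi> k. if k = m then row m (mat 1) + 1 *s row n (mat 1) else row k (mat 1))"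
    by (auto simp: matrix_def f_def vec_eq_iff axis_def mat_def row_def)
  moreover have "det (\<chi> k. if k = m then row m (mat 1) + 1 *s row n (mat 1) else row k (mat 1)) =
      det (mat 1 :: real^'n^'n)"
    by (rule det_row_operation) fact
  ultimately have det: "det (matrix f) = 1" by simp
  have "measure lebesgue (f ` cbox a b) = measure lebesgue (cbox a b)" for a b
  proof (cases "cbox a b = {}")
    case False
    \<comment> \<open>After a translation the box starts at the origin, so that the shear meets only
      nonnegative coordinates.\<close>
    let ?C = "cbox 0 (b - a)"
    have ab: "cbox a b = (+) a ` ?C"
      using cbox_translation[of a 0 "b - a"] by simp
    have "f ` cbox a b = (+) (f a) ` f ` ?C"
      unfolding ab image_image by (simp add: linear_add[OF lin])
    then have "measure lebesgue (f ` cbox a b) = measure lebesgue (f ` ?C)"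
      by (simp add: measure_translation)
    also have "\<dots> = measure lebesgue ?C"
      unfolding f_def using False ab \<open>m \<noteq> n\<close> by (intro measure_shear_interval) auto
    also have "\<dots> = measure lebesgue (cbox a b)"
      using measure_translation[of a ?C] by (simp only: ab)
    finally show ?thesis .
  qed simp
  then show ?thesis
    using measure_linear_sufficient[OF lin \<open>S \<in> lmeasurable\<close>, of 1] det by simp
qed

text \<open>
  Elementary factors suffice, because the claim is preserved by composition.
\<close>

lemma linear_image_scales_measure:
  fixes f :: "real^'n \<Rightarrow> real^'n"
  assumes "linear f"
  shows "\<forall>S\<in>lmeasurable. f ` S \<in> lmeasurable \<and>
           measure lebesgue (f ` S) = \<bar>det (matrix f)\<bar> * measure lebesgue S"
proof (rule induct_linear_elementary[OF \<open>linear f\<close>], goal_cases)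
  case (1 f g)
  then show ?case
    unfolding image_comp[symmetric] matrix_compose[OF 1(2,1)] det_mul abs_mult mult.assoc
    by auto
next
  case (2 f i)
  have "f x \<noteq> axis i 1" for x
    using 2(2)[of x] by (auto simp: axis_def vec_eq_iff)
  then have "\<not> inj f"
    using linear_injective_imp_surjective[OF 2(1)] by (metis surjD)
  then have "det (matrix f) = 0"
    using det_nz_iff_inj[OF 2(1)] by blast
  moreover have "negligible (f ` S)" for S
    using negligible_linear_singular_image[OF 2(1) \<open>\<not> inj f\<close>] .
  ultimately show ?case
    by (auto simp: negligible_iff_measure)
next
  case (3 c)
  have "det (matrix (\<lambda>x. \<chi> i. c i * x $ i)) = prod c UNIV"
    by (subst det_diagonal) (auto simp: matrix_def axis_def)
  then show ?case
    by (auto simp: measurable_stretch measure_stretch)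
next
  case (4 m n)
  then show ?case using swap_coordinates_scales_measure by blast
next
  case (5 m n)
  then show ?case using shear_scales_measure by blast
qed

lemma SL_invertible:
  assumes "A \<in> SL"
  shows "A ** matrix_inv A = mat 1" "matrix_inv A ** A = mat 1" "matrix_inv A \<in> SL"
proof -
  have inv: "invertible A"
    using assms by (simp add: SL_def invertible_det_nz)
  show 1: "A ** matrix_inv A = mat 1" and "matrix_inv A ** A = mat 1"
    using inv unfolding invertible_def matrix_inv_def by (metis (mono_tags, lifting) someI_ex)+
  have "det A * det (matrix_inv A) = 1"
    using det_mul[of A "matrix_inv A"] 1 by simp
  then show "matrix_inv A \<in> SL"
    using assms by (simp add: SL_def)
qed

lemma borel_measurable_matrix_vector [measurable]:
  "(\<lambda>v. A *v v) \<in> borel_measurable (borel :: (real^'n) measure)" for A :: "real^'n^'n"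
  by (intro borel_measurable_continuous_onI linear_continuous_on matrix_vector_mul_bounded_linear)

text \<open>
  This is what makes \<open>f \<mapsto> f \<circ> A\<close> an isometry of square integrable functions. It suffices to look
  at boxes, whose preimages under \<open>A\<close> are their images under the inverse matrix.
\<close>

proposition distr_lborel_SL:
  fixes A :: "real^'n^'n"
  assumes A: "A \<in> SL"
  shows "distr lborel borel (\<lambda>v. A *v v) = lborel"
proof (rule lborel_eqI[symmetric])
  fix l u :: "real^'n"
  assume lu: "\<And>b. b \<in> Basis \<Longrightarrow> l \<bullet> b \<le> u \<bullet> b"
  let ?B = "matrix_inv A"
  have *: "(\<lambda>v. A *v v) -` box l u = (\<lambda>v. ?B *v v) ` box l u"
  proof (intro set_eqI iffI)
    fix x assume "x \<in> (\<lambda>v. A *v v) -` box l u"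
    then show "x \<in> (\<lambda>v. ?B *v v) ` box l u"
      by (intro image_eqI[of _ _ "A *v x"])
        (auto simp: matrix_vector_mul_assoc SL_invertible[OF A])
  qed (auto simp: matrix_vector_mul_assoc SL_invertible[OF A])
  have "(\<lambda>v. ?B *v v) ` box l u \<in> lmeasurable \<and>
      measure lebesgue ((\<lambda>v. ?B *v v) ` box l u) = measure lebesgue (box l u)"
    using linear_image_scales_measure[of "(*v) ?B"] SL_invertible[OF A]
    by (simp add: SL_def matrix_vector_mul_linear)
  then have "emeasure lebesgue ((\<lambda>v. A *v v) -` box l u) = emeasure lborel (box l u)"
    unfolding * by (simp add: emeasure_eq_measure2 fmeasurableD2 measure_completion)
  moreover have "(\<lambda>v. A *v v) -` box l u \<in> sets borel"
    using measurable_sets[OF borel_measurable_matrix_vector, of "box l u" A] by simp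
  ultimately show "emeasure (distr lborel borel (\<lambda>v. A *v v)) (box l u) = (\<Prod>b\<in>Basis. (u - l) \<bullet> b)"
    using lu by (subst emeasure_distr) (auto simp: emeasure_completion emeasure_lborel_box)
qed simp

section \<open>Borel probability measures and continuous maps\<close>

lemma measurable_continuous_map:
  assumes "continuous_map X Y f"
  shows "f \<in> borel_of X \<rightarrow>\<^sub>M borel_of Y"
proof (rule measurable_sigma_sets[OF sets_borel_of])
  show "f \<in> space (borel_of X) \<rightarrow> topspace Y"
    using assms by (auto simp: space_borel_of continuous_map_def)
  fix U assume "U \<in> {U. openin Y U}"
  then have "openin X {x \<in> topspace X. f x \<in> U}"
    using assms by (simp add: continuous_map_def)
  moreover have "f -` U \<inter> space (borel_of X) = {x \<in> topspace X. f x \<in> U}"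
    by (auto simp: space_borel_of)
  ultimately show "f -` U \<inter> space (borel_of X) \<in> sets (borel_of X)"
    by (simp add: sets_borel_of sigma_sets.Basic)
qed (auto dest: openin_subset)

lemma distr_borel_probs:
  assumes M: "M \<in> borel_probs X" and f: "continuous_map X Y f"
  shows "distr M (borel_of Y) f \<in> borel_probs Y" "f \<in> M \<rightarrow>\<^sub>M borel_of Y"
proof -
  show f': "f \<in> M \<rightarrow>\<^sub>M borel_of Y"
    using measurable_continuous_map[OF f] M by (simp add: borel_probs_def cong: measurable_cong_sets)
  show "distr M (borel_of Y) f \<in> borel_probs Y"
    using M prob_space.prob_space_distr[OF _ f'] by (auto simp: borel_probs_def)
qed

lemma space_borel_probs: "M \<in> borel_probs X \<Longrightarrow> space M = topspace X"
  by (auto simp: borel_probs_def space_borel_of dest: sets_eq_imp_space_eq)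

lemma integrable_bounded_continuous:
  fixes f :: "'a::topological_space \<Rightarrow> real"
  assumes M: "M \<in> borel_probs (top_of_set S)" and f: "continuous_on S f"
    and B: "\<And>x. x \<in> S \<Longrightarrow> \<bar>f x\<bar> \<le> B"
  shows "integrable M f"
proof -
  interpret prob_space M using M by (simp add: borel_probs_def)
  have "sets M = sets (restrict_space borel S)"
    using M by (simp add: borel_probs_def sets_borel_of_subtopology)
  then have "f \<in> borel_measurable M"
    using borel_measurable_continuous_on_restrict[OF f] by (simp cong: measurable_cong_sets)
  then show ?thesis
    using B space_borel_probs[OF M] by (intro integrable_const_bound[of _ B]) auto
qed

lemma openin_weak_topology_integral:
  fixes f :: "'a::topological_space \<Rightarrow> real"
  assumes f: "continuous_on S f" and B: "\<And>x. x \<in> S \<Longrightarrow> \<bar>f x\<bar> \<le> B" and U: "open U"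
  shows "openin (weak_topology (top_of_set S)) {M \<in> borel_probs (top_of_set S). (\<integral>x. f x \<partial>M) \<in> U}"
  unfolding weak_topology_def
proof (rule topology_generated_by_Basis)
  have "bounded (f ` S)" using B by (auto simp: bounded_iff)
  then show "{M \<in> borel_probs (top_of_set S). (\<integral>x. f x \<partial>M) \<in> U} \<in>
    {{M \<in> borel_probs (top_of_set S). integral\<^sup>L M f \<in> U} | (f :: 'a \<Rightarrow> real) U.
       continuous_map (top_of_set S) euclidean f \<and> bounded (f ` topspace (top_of_set S)) \<and> open U}"
    using f U by (intro CollectI exI[of _ f] exI[of _ U]) auto
qed

text \<open>
  Truncated multiples of the distance to the complement increase to the indicator function. If the
  complement is empty its distance function is identically zero, so that case is separate.
\<close>

lemma open_indicator_limit:
  fixes T :: "'a::metric_space set"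
  assumes "open T"
  obtains h :: "nat \<Rightarrow> 'a \<Rightarrow> real"
  where "\<And>k. continuous_on UNIV (h k)" "\<And>k x. 0 \<le> h k x \<and> h k x \<le> 1"
    "\<And>x. (\<lambda>k. h k x) \<longlonglongrightarrow> indicator T x"
proof (cases "T = UNIV")
  case True
  then show thesis by (intro that[of "\<lambda>_ _. 1"]) auto
next
  case False
  show thesis
  proof (rule that[of "\<lambda>k x. min 1 (real k * infdist x (- T))"])
    fix x
    show "(\<lambda>k. min 1 (real k * infdist x (- T))) \<longlonglongrightarrow> indicator T x"
    proof (cases "x \<in> T")
      case True
      have "infdist x (- T) \<noteq> 0"
        using True False assms in_closed_iff_infdist_zero[of "- T" x] by auto
      then have d: "0 < infdist x (- T)" using infdist_nonneg[of x "- T"] by linarith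
      obtain m :: nat where m: "1 < real m * infdist x (- T)"
        using reals_Archimedean3[OF d] by blast
      have "min 1 (real k * infdist x (- T)) = 1" if "m \<le> k" for k
      proof -
        have "real m * infdist x (- T) \<le> real k * infdist x (- T)"
          using that d by (intro mult_right_mono) auto
        then show ?thesis using m by simp
      qed
      then show ?thesis
        using True by (intro tendsto_eventually) (auto simp: eventually_at_top_linorder)
    qed (simp add: infdist_zero)
  qed (auto intro!: continuous_intros simp: infdist_nonneg)
qed

lemma integral_indicator_limit:
  fixes h :: "nat \<Rightarrow> 'a::metric_space \<Rightarrow> real"
  assumes M: "M \<in> borel_probs (top_of_set S)" and T: "open T"
    and h: "\<And>k. continuous_on S (h k)" "\<And>k x. 0 \<le> h k x \<and> h k x \<le> 1"
    and lim: "\<And>x. (\<lambda>k. h k x) \<longlonglongrightarrow> indicator T x"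
  shows "(\<lambda>k. \<integral>x. h k x \<partial>M) \<longlonglongrightarrow> measure M (S \<inter> T)"
proof -
  interpret prob_space M using M by (simp add: borel_probs_def)
  have sp: "space M = S" using space_borel_probs[OF M] by simp
  have setsM: "sets M = sets (restrict_space borel S)"
    using M by (simp add: borel_probs_def sets_borel_of_subtopology)
  have ST: "S \<inter> T \<in> sets M"
    using T by (auto simp: setsM sets_restrict_space)
  have ind: "indicator T x = (indicator (S \<inter> T) x :: real)" if "x \<in> space M" for x
    using that by (auto simp: indicator_def sp)
  have "(\<lambda>k. \<integral>x. h k x \<partial>M) \<longlonglongrightarrow> (\<integral>x. indicator (S \<inter> T) x \<partial>M)"
  proof (rule integral_dominated_convergence[where w = "\<lambda>_. 1"])
    show "h k \<in> borel_measurable M" for k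
      using integrable_bounded_continuous[OF M h(1), of k 1] h(2) by (auto simp: abs_le_iff intro: order_trans[of _ 0])
    show "AE x in M. (\<lambda>k. h k x) \<longlonglongrightarrow> indicator (S \<inter> T) x"
      using lim by (intro AE_I2) (simp flip: ind)
  qed (use h(2) ST in auto)
  then show ?thesis using sets.Int_space_eq2[OF ST] by simp
qed

text \<open>
  Equality of two measures becomes countably many equations, so it can be derived from equations
  that each hold almost everywhere. The family consists of the finite unions of a countable basis;
  open sets are increasing limits of these, and open sets generate the Borel sets.
\<close>

lemma countable_determining_family:
  fixes S :: "'a::{metric_space,second_countable_topology} set"
  obtains \<U> where "countable \<U>" "\<And>T. T \<in> \<U> \<Longrightarrow> open T"
    "\<And>M N. M \<in> borel_probs (top_of_set S) \<Longrightarrow> N \<in> borel_probs (top_of_set S) \<Longrightarrow>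
       (\<And>T. T \<in> \<U> \<Longrightarrow> measure M (S \<inter> T) = measure N (S \<inter> T)) \<Longrightarrow> M = N"
proof -
  obtain B :: "'a set set" where B: "countable B" "topological_basis B"
    using ex_countable_basis by blast
  define \<U> where "\<U> = Union ` {F. finite F \<and> F \<subseteq> B}"
  show thesis
  proof (rule that)
    show "countable \<U>"
      unfolding \<U>_def using B(1) by (intro countable_image countable_Collect_finite_subset)
    show "open T" if "T \<in> \<U>" for T
      using that topological_basis_open[OF B(2)] by (auto simp: \<U>_def)
    fix M N :: "'a measure"
    assume M: "M \<in> borel_probs (top_of_set S)" and N: "N \<in> borel_probs (top_of_set S)"
      and eq: "\<And>T. T \<in> \<U> \<Longrightarrow> measure M (S \<inter> T) = measure N (S \<inter> T)"
    interpret M: prob_space M using M by (simp add: borel_probs_def)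
    interpret N: prob_space N using N by (simp add: borel_probs_def)
    have sets: "sets M = sigma_sets S {U. openin (top_of_set S) U}"
      "sets N = sigma_sets S {U. openin (top_of_set S) U}"
      using M N by (simp_all add: borel_probs_def sets_borel_of)
    have *: "measure M (S \<inter> T) = measure N (S \<inter> T)" if T: "open T" for T
    proof -
      obtain B' where B': "B' \<subseteq> B" "T = \<Union>B'"
        using B(2) T by (auto simp: topological_basis_def)
      show ?thesis
      proof (cases "B' = {}")
        case False
        have cB': "countable B'" using B'(1) B(1) countable_subset by blast
        define A where "A n = S \<inter> (\<Union>i\<le>n. from_nat_into B' i)" for n :: nat
        have in_U: "(\<Union>i\<le>n. from_nat_into B' i) \<in> \<U>" for n
        proof -
          have "from_nat_into B' ` {..n} \<subseteq> B" using from_nat_into[OF False] B'(1) by blast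
          then show ?thesis unfolding \<U>_def by (intro image_eqI[of _ _ "from_nat_into B' ` {..n}"]) auto
        qed
        have "incseq A" by (force simp: incseq_def A_def)
        moreover have "openin (top_of_set S) (A n)" for n
        proof -
          have "open (from_nat_into B' i)" for i
            using topological_basis_open[OF B(2)] from_nat_into[OF False] B'(1) by blast
          then show ?thesis unfolding A_def by (intro openin_open_Int open_UN ballI)
        qed
        then have "range A \<subseteq> sets M" "range A \<subseteq> sets N"
          unfolding sets by (intro image_subsetI sigma_sets.Basic CollectI; assumption)+
        ultimately have "(\<lambda>n. measure M (A n)) \<longlonglongrightarrow> measure M (\<Union>n. A n)"
          "(\<lambda>n. measure N (A n)) \<longlonglongrightarrow> measure N (\<Union>n. A n)"
          using M.finite_Lim_measure_incseq N.finite_Lim_measure_incseq by blast+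
        moreover have "measure M (A n) = measure N (A n)" for n
          unfolding A_def by (rule eq[OF in_U])
        moreover have "(\<Union>n. A n) = S \<inter> T"
        proof -
          have "T = (\<Union>i. from_nat_into B' i)"
            using B'(2) range_from_nat_into[OF False cB'] by simp
          then show ?thesis by (auto simp: A_def)
        qed
        ultimately show ?thesis by (auto intro: LIMSEQ_unique)
      qed (simp add: B')
    qed
    show "M = N"
    proof (rule measure_eqI_generator_eq[OF _ _ _ sets])
      show "Int_stable {U. openin (top_of_set S) U}" by (auto simp: Int_stable_def)
      show "{U. openin (top_of_set S) U} \<subseteq> Pow S" using openin_imp_subset by auto
      show "range (\<lambda>_::nat. S) \<subseteq> {U. openin (top_of_set S) U}" by auto
      show "emeasure M U = emeasure N U" if "U \<in> {U. openin (top_of_set S) U}" for U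
        using that * by (auto simp: openin_open M.emeasure_eq_measure N.emeasure_eq_measure)
    qed auto
  qed
qed

section \<open>Normalized positive functionals on a compact metric space\<close>

text \<open>
  These are the states of the commutative C*-algebra of continuous functions on \<open>S\<close>. Functionals are
  total, so the value at a discontinuous function is fixed to be zero; without this convention the
  set would in general be unbounded in that coordinate, hence not compact.
\<close>

definition states :: "'a::metric_space set \<Rightarrow> (('a \<Rightarrow> real) \<Rightarrow> real) set" where
  "states S = {L.
     (\<forall>f g. continuous_on S f \<longrightarrow> continuous_on S g \<longrightarrow> L (\<lambda>x. f x + g x) = L f + L g) \<and>
     (\<forall>c f. continuous_on S f \<longrightarrow> L (\<lambda>x. c * f x) = c * L f) \<and>
     (\<forall>f. continuous_on S f \<longrightarrow> (\<forall>x\<in>S. 0 \<le> f x) \<longrightarrow> 0 \<le> L f) \<and>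
     L (\<lambda>_. 1) = 1 \<and> (\<forall>f. \<not> continuous_on S f \<longrightarrow> L f = 0)}"

lemma
  assumes "L \<in> states S"
  shows states_add: "continuous_on S f \<Longrightarrow> continuous_on S g \<Longrightarrow> L (\<lambda>x. f x + g x) = L f + L g"
    and states_cmult: "continuous_on S f \<Longrightarrow> L (\<lambda>x. c * f x) = c * L f"
    and states_nonneg: "continuous_on S f \<Longrightarrow> (\<And>x. x \<in> S \<Longrightarrow> 0 \<le> f x) \<Longrightarrow> 0 \<le> L f"
    and states_one: "L (\<lambda>_. 1) = 1"
  using assms unfolding states_def by auto

lemma states_const: "L \<in> states S \<Longrightarrow> L (\<lambda>_. c) = c"
  using states_cmult[of L S "\<lambda>_. 1" c] states_one[of L S] by simp

lemma states_diff:
  assumes "L \<in> states S" "continuous_on S f" "continuous_on S g"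
  shows "L (\<lambda>x. f x - g x) = L f - L g"
  using states_add[OF assms(1,2), of "\<lambda>x. -1 * g x"] states_cmult[OF assms(1,3), of "-1"] assms(3)
  by (simp add: continuous_on_minus)

lemma states_mono:
  assumes "L \<in> states S" "continuous_on S f" "continuous_on S g" "\<And>x. x \<in> S \<Longrightarrow> f x \<le> g x"
  shows "L f \<le> L g"
  using states_diff[OF assms(1,3,2)] states_nonneg[OF assms(1), of "\<lambda>x. g x - f x"] assms
  by (simp add: continuous_on_diff)

lemma states_bound:
  assumes "L \<in> states S" "continuous_on S f" "\<And>x. x \<in> S \<Longrightarrow> \<bar>f x\<bar> \<le> c"
  shows "\<bar>L f\<bar> \<le> c"
proof -
  have "L f \<le> L (\<lambda>_. c)" "L (\<lambda>_. - c) \<le> L f"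
    using assms(3) by (auto intro!: states_mono[OF assms(1)] assms(2) simp: abs_le_iff)
      (use assms(3) in \<open>fastforce simp: abs_le_iff\<close>)
  then show ?thesis by (simp add: states_const[OF assms(1)] abs_le_iff)
qed

lemma states_sum:
  assumes L: "L \<in> states S" and "finite I" "\<And>i. i \<in> I \<Longrightarrow> continuous_on S (f i)"
  shows "L (\<lambda>x. \<Sum>i\<in>I. f i x) = (\<Sum>i\<in>I. L (f i))"
  using assms(2,3)
proof (induction rule: finite_induct)
  case empty
  then show ?case using states_const[OF L, of 0] by simp
next
  case (insert i I)
  then show ?case
    using states_add[OF L, of "f i" "\<lambda>x. \<Sum>i\<in>I. f i x"] by (simp add: continuous_on_sum)
qed

text \<open>
  The set is closed in a product of compact intervals, since all defining conditions are closed
  conditions on finitely many coordinates.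
\<close>

lemma compact_states:
  fixes S :: "'a::metric_space set"
  assumes S: "compact S"
  shows "compact (states S)"
proof -
  have "\<exists>c. \<forall>x\<in>S. \<bar>f x\<bar> \<le> c" if "continuous_on S f" for f :: "'a \<Rightarrow> real"
  proof -
    have "bounded (f ` S)"
      using S that compact_continuous_image compact_imp_bounded by blast
    then show ?thesis by (auto simp: bounded_iff)
  qed
  then obtain c where c: "\<And>(f :: 'a \<Rightarrow> real) x. continuous_on S f \<Longrightarrow> x \<in> S \<Longrightarrow> \<bar>f x\<bar> \<le> c f"
    by metis
  define B where "B f = (if continuous_on S f then {- c f .. c f} else {0})" for f
  have "compactin (product_topology (\<lambda>_. euclidean) UNIV) (PiE UNIV B)"
    by (subst compactin_PiE) (auto simp: B_def)
  then have "compact (PiE UNIV B)"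
    by (simp add: euclidean_product_topology)
  moreover have "states S \<subseteq> PiE UNIV B"
  proof
    fix L assume L: "L \<in> states S"
    have "\<bar>L f\<bar> \<le> c f" if "continuous_on S f" for f
      using states_bound[OF L that c[OF that]] by simp
    moreover have "L f = 0" if "\<not> continuous_on S f" for f
      using L that by (auto simp: states_def)
    ultimately show "L \<in> PiE UNIV B"
      by (auto simp: B_def abs_le_iff PiE_iff minus_le_iff)
  qed
  moreover have "closed (states S)"
    unfolding states_def
    by (intro closed_Collect_conj closed_Collect_all closed_Collect_imp closed_Collect_eq
        closed_Collect_le continuous_intros continuous_on_product_coordinates open_Collect_const)
  ultimately show ?thesis
    using compact_Int_closed[of "PiE UNIV B" "states S"] by (simp add: Int_absorb1)
qed

section \<open>Functionals are represented by measures\<close>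

definition subordinate :: "'a::metric_space set \<Rightarrow> 'a set \<Rightarrow> ('a \<Rightarrow> real) set" where
  "subordinate S U = {f. continuous_on S f \<and> (\<forall>x\<in>S. 0 \<le> f x \<and> f x \<le> indicator U x)}"

text \<open>
  The set functions \<open>open_mass\<close> and \<open>outer_mass\<close> are those from the proof of the Riesz representation
  theorem. The Caratheodory construction turns the second one into the representing measure.
\<close>

definition open_mass :: "'a::metric_space set \<Rightarrow> (('a \<Rightarrow> real) \<Rightarrow> real) \<Rightarrow> 'a set \<Rightarrow> ennreal" where
  "open_mass S L U = (SUP f\<in>subordinate S U. ennreal (L f))"

definition outer_mass :: "'a::metric_space set \<Rightarrow> (('a \<Rightarrow> real) \<Rightarrow> real) \<Rightarrow> 'a set \<Rightarrow> ennreal" where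
  "outer_mass S L E = (INF U\<in>{U. openin (top_of_set S) U \<and> E \<subseteq> U}. open_mass S L U)"

lemma subordinate_iff:
  "f \<in> subordinate S U \<longleftrightarrow>
     continuous_on S f \<and> (\<forall>x\<in>S. 0 \<le> f x \<and> f x \<le> 1 \<and> (x \<notin> U \<longrightarrow> f x = 0))"
proof -
  have "0 \<le> f x \<and> f x \<le> indicator U x \<longleftrightarrow> 0 \<le> f x \<and> f x \<le> 1 \<and> (x \<notin> U \<longrightarrow> f x = 0)" for x
    by (cases "x \<in> U") auto
  then show ?thesis by (simp add: subordinate_def)
qed

lemma zero_subordinate: "(\<lambda>_. 0) \<in> subordinate S U"
  by (auto simp: subordinate_def)

lemma open_mass_upper: "f \<in> subordinate S U \<Longrightarrow> ennreal (L f) \<le> open_mass S L U"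
  unfolding open_mass_def by (rule SUP_upper)

lemma open_mass_mono: "U \<subseteq> V \<Longrightarrow> open_mass S L U \<le> open_mass S L V"
  unfolding open_mass_def
  by (rule SUP_subset_mono) (auto simp: subordinate_def indicator_def split: if_splits)

lemma open_mass_le_1:
  assumes "L \<in> states S"
  shows "open_mass S L U \<le> 1"
  unfolding open_mass_def
proof (rule SUP_least)
  fix f assume f: "f \<in> subordinate S U"
  have "L f \<le> 1"
    using states_mono[OF assms, of f "\<lambda>_. 1"] states_one[OF assms] f by (auto simp: subordinate_iff)
  then show "ennreal (L f) \<le> 1" by simp
qed

lemma open_mass_empty:
  assumes "L \<in> states S"
  shows "open_mass S L {} = 0"
proof -
  have "L f = 0" if "f \<in> subordinate S {}" for f
    using states_bound[OF assms, of f 0] that by (simp add: subordinate_iff)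
  then show ?thesis
    unfolding open_mass_def by (metis (no_types, lifting) SUP_least ennreal_0 le_zero_eq)
qed

lemma open_mass_whole:
  assumes "L \<in> states S"
  shows "open_mass S L S = 1"
  using open_mass_le_1[OF assms, of S] open_mass_upper[of "\<lambda>_. 1" S S L] states_one[OF assms]
  by (auto simp: subordinate_def intro: antisym)

lemma outer_mass_open:
  assumes "openin (top_of_set S) U"
  shows "outer_mass S L U = open_mass S L U"
  unfolding outer_mass_def
  by (rule antisym) (use assms in \<open>auto intro!: INF_lower INF_greatest open_mass_mono\<close>)

lemma outer_mass_lower: "openin (top_of_set S) U \<Longrightarrow> E \<subseteq> U \<Longrightarrow> outer_mass S L E \<le> open_mass S L U"
  unfolding outer_mass_def by (intro INF_lower) auto

text \<open>
  Given \<open>f\<close> below the indicator of the union, the compact set where \<open>f \<ge> e\<close> is covered by finitely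
  many \<open>U i\<close>. Distances to their complements yield a partition of unity there, which distributes
  \<open>max 0 (f - e)\<close> over those \<open>U i\<close>.
\<close>

lemma open_mass_countably_subadditive:
  fixes U :: "nat \<Rightarrow> 'a::metric_space set"
  assumes S: "compact S" and L: "L \<in> states S" and U: "\<And>i. openin (top_of_set S) (U i)"
  shows "open_mass S L (\<Union>i. U i) \<le> (\<Sum>i. open_mass S L (U i))"
  unfolding open_mass_def[of S L "\<Union>i. U i"]
proof (rule SUP_least)
  fix f assume "f \<in> subordinate S (\<Union>i. U i)"
  then have fc: "continuous_on S f" and f0: "\<And>x. x \<in> S \<Longrightarrow> 0 \<le> f x"
    and f1: "\<And>x. x \<in> S \<Longrightarrow> f x \<le> indicator (\<Union>i. U i) x"
    by (auto simp: subordinate_def)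
  have f1': "f x \<le> 1" if "x \<in> S" for x
    using f1[OF that] indicator_le_1[of "\<Union>i. U i" x, where 'a = real] by (rule order_trans)
  obtain T where T: "\<And>i. open (T i)" "\<And>i. U i = S \<inter> T i"
    using U unfolding openin_open by metis
  show "ennreal (L f) \<le> (\<Sum>i. open_mass S L (U i))"
  proof (rule ennreal_le_epsilon)
    fix e :: real assume e: "0 < e"
    let ?C = "{x \<in> S. e \<le> f x}"
    have "closedin (top_of_set S) ?C"
      using continuous_closedin_preimage[OF fc, of "{e..}"] by (simp add: vimage_def Int_def)
    then have "compact ?C" using S closedin_compact by blast
    moreover have "?C \<subseteq> (\<Union>i. T i)"
    proof
      fix x assume x: "x \<in> ?C"
      have "x \<in> (\<Union>i. U i)"
      proof (rule ccontr)
        assume "x \<notin> (\<Union>i. U i)"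
        then show False using f1[of x] x e by simp
      qed
      then show "x \<in> (\<Union>i. T i)" using T(2) by blast
    qed
    ultimately obtain I where I: "finite I" "?C \<subseteq> (\<Union>i\<in>I. T i)"
      using compactE_image[of ?C UNIV T] T(1) by metis
    define d where "d i x = (if S - U i = {} then 1 else infdist x (S - U i))" for i x
    have d_cont: "continuous_on S (d i)" for i
      by (cases "S \<subseteq> U i") (simp_all add: d_def Diff_eq_empty_iff continuous_on_infdist continuous_on_id)
    have d_nonneg: "0 \<le> d i x" for i x
      by (simp add: d_def infdist_nonneg)
    have d_pos: "0 < d i x \<longleftrightarrow> x \<in> U i" if "x \<in> S" for i x
    proof -
      have "closed (S - U i)"
        using S T by (simp add: Diff_Int closed_Diff compact_imp_closed)
      then have "infdist x (S - U i) = 0 \<longleftrightarrow> x \<in> S - U i" if "S - U i \<noteq> {}"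
        using that by (metis in_closed_iff_infdist_zero)
      then show ?thesis
        using that infdist_nonneg[of x "S - U i"] by (auto simp: d_def less_le)
    qed
    \<comment> \<open>The second summand keeps the denominator positive where \<open>f x < e\<close>, outside
      the covered set, and vanishes where the numerator below does not.\<close>
    define g where "g x = (\<Sum>i\<in>I. d i x) + max 0 (e - f x)" for x
    have g_pos: "0 < g x" if x: "x \<in> S" for x
    proof (cases "e \<le> f x")
      case True
      then obtain i where i: "i \<in> I" "x \<in> U i" using I x T(2) by blast
      then have "0 < (\<Sum>i\<in>I. d i x)"
        using d_pos[OF x] d_nonneg I(1) by (intro sum_pos2[of I i]) auto
      then show ?thesis by (simp add: g_def)
    next
      case False
      then show ?thesis
        using sum_nonneg[of I "\<lambda>i. d i x"] d_nonneg by (simp add: g_def add_nonneg_pos)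
    qed
    define h where "h i x = d i x / g x * max 0 (f x - e)" for i x
    have gc: "continuous_on S g"
      unfolding g_def by (intro continuous_intros d_cont fc)
    have hc: "continuous_on S (h i)" for i
      unfolding h_def using g_pos by (intro continuous_intros d_cont fc gc) force
    have h_sub: "h i \<in> subordinate S (U i)" if "i \<in> I" for i
    proof -
      have "0 \<le> h i x" "h i x \<le> indicator (U i) x" if x: "x \<in> S" for x
      proof -
        show "0 \<le> h i x"
          using g_pos[OF x] d_nonneg[of i x] by (simp add: h_def)
        have "d i x \<le> (\<Sum>i\<in>I. d i x)"
          using \<open>i \<in> I\<close> I(1) d_nonneg by (intro member_le_sum) auto
        then have "d i x / g x \<le> 1"
          using g_pos[OF x] by (simp add: g_def)
        then have "h i x \<le> 1 * 1"
          unfolding h_def using f1'[OF x] e d_nonneg g_pos[OF x] by (intro mult_mono) auto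
        moreover have "h i x = 0" if "x \<notin> U i"
          using d_pos[OF x, of i] that d_nonneg[of i x] by (simp add: h_def less_le)
        ultimately show "h i x \<le> indicator (U i) x"
          by (auto simp: indicator_def)
      qed
      then show ?thesis using hc by (auto simp: subordinate_def)
    qed
    have "f x - e \<le> (\<Sum>i\<in>I. h i x)" if x: "x \<in> S" for x
    proof (cases "f x \<le> e")
      case False
      then have "g x = (\<Sum>i\<in>I. d i x)" by (simp add: g_def)
      then show ?thesis
        using g_pos[OF x] False
        by (simp add: h_def flip: sum_distrib_right sum_divide_distrib)
    qed (simp add: h_def)
    then have "L (\<lambda>x. f x - e) \<le> L (\<lambda>x. \<Sum>i\<in>I. h i x)"
      by (intro states_mono[OF L] continuous_intros fc hc)
    also have "\<dots> = (\<Sum>i\<in>I. L (h i))"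
      using I(1) hc by (intro states_sum[OF L])
    finally have "L f \<le> (\<Sum>i\<in>I. L (h i)) + e"
      using states_diff[OF L fc, of "\<lambda>_. e"] states_const[OF L, of e] by simp
    moreover have nn: "0 \<le> L (h i)" if "i \<in> I" for i
      using h_sub[OF that] by (intro states_nonneg[OF L]) (auto simp: subordinate_def)
    ultimately have "ennreal (L f) \<le> ennreal (\<Sum>i\<in>I. L (h i)) + ennreal e"
      using e by (subst ennreal_plus[symmetric]) (auto intro!: sum_nonneg ennreal_leI simp del: ennreal_plus)
    also have "ennreal (\<Sum>i\<in>I. L (h i)) = (\<Sum>i\<in>I. ennreal (L (h i)))"
      using nn by (simp add: sum_ennreal)
    also have "\<dots> \<le> (\<Sum>i\<in>I. open_mass S L (U i))"
      by (intro sum_mono open_mass_upper h_sub)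
    also have "\<dots> \<le> (\<Sum>i. open_mass S L (U i))"
      using I(1) by (intro sum_le_suminf) auto
    finally show "ennreal (L f) \<le> (\<Sum>i. open_mass S L (U i)) + ennreal e" by simp
  qed
qed

lemma outer_mass_outer_measure:
  assumes S: "compact S" and L: "L \<in> states S"
  shows "outer_measure_space (Pow S) (outer_mass S L)"
  unfolding outer_measure_space_def
proof (intro conjI)
  show "positive (Pow S) (outer_mass S L)"
    using outer_mass_open[of S "{}" L] open_mass_empty[OF L] by (simp add: positive_def)
  show "increasing (Pow S) (outer_mass S L)"
    unfolding increasing_def outer_mass_def by (auto intro!: INF_superset_mono)
  show "countably_subadditive (Pow S) (outer_mass S L)"
    unfolding countably_subadditive_def
  proof (intro allI impI)
    fix A :: "nat \<Rightarrow> 'a set" assume A: "range A \<subseteq> Pow S"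
    show "outer_mass S L (\<Union>i. A i) \<le> (\<Sum>i. outer_mass S L (A i))"
    proof (rule ennreal_le_epsilon)
      fix e :: real assume e: "0 < e"
      have "\<exists>U. openin (top_of_set S) U \<and> A i \<subseteq> U \<and>
          open_mass S L U \<le> outer_mass S L (A i) + ennreal (e * (1/2) ^ Suc i)" for i
      proof -
        have "outer_mass S L (A i) \<le> open_mass S L S"
          using A by (intro outer_mass_lower) auto
        then have "outer_mass S L (A i) < \<top>"
          using open_mass_whole[OF L] by (auto intro: le_less_trans)
        then have "outer_mass S L (A i) < outer_mass S L (A i) + ennreal (e * (1/2) ^ Suc i)"
          using e by (simp add: ennreal_add_left_cancel_less[of _ 0, simplified])
        then have "\<exists>U\<in>{U. openin (top_of_set S) U \<and> A i \<subseteq> U}.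
            open_mass S L U < outer_mass S L (A i) + ennreal (e * (1/2) ^ Suc i)"
          by (subst (asm) outer_mass_def) (simp only: INF_less_iff)
        then show ?thesis by (auto intro: less_imp_le)
      qed
      then obtain U where U: "\<And>i. openin (top_of_set S) (U i)" "\<And>i. A i \<subseteq> U i"
          "\<And>i. open_mass S L (U i) \<le> outer_mass S L (A i) + ennreal (e * (1/2) ^ Suc i)"
        by metis
      have "outer_mass S L (\<Union>i. A i) \<le> open_mass S L (\<Union>i. U i)"
        using U(1,2) by (intro outer_mass_lower) auto
      also have "\<dots> \<le> (\<Sum>i. open_mass S L (U i))"
        by (intro open_mass_countably_subadditive S L U)
      also have "\<dots> \<le> (\<Sum>i. outer_mass S L (A i) + ennreal (e * (1/2) ^ Suc i))"
        by (intro suminf_le U summableI)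
      also have "\<dots> = (\<Sum>i. outer_mass S L (A i)) + (\<Sum>i. ennreal (e * (1/2) ^ Suc i))"
        by (intro suminf_add[symmetric] summableI)
      also have "(\<Sum>i. ennreal (e * (1/2) ^ Suc i)) = ennreal e"
        using e sums_mult[OF power_half_series, of e] by (intro suminf_ennreal_eq) auto
      finally show "outer_mass S L (\<Union>i. A i) \<le> (\<Sum>i. outer_mass S L (A i)) + ennreal e" .
    qed
  qed
qed


text \<open>
  This is the Caratheodory condition for open sets. A function \<open>f\<close> supported in \<open>V \<inter> U\<close> uses up the
  mass of \<open>V\<close> except where \<open>f\<close> is small, and \<open>E - U\<close> lies inside the open set where \<open>f < t\<close>; adding
  a function \<open>g\<close> supported there overshoots the bound one by at most \<open>t\<close>.
\<close>

lemma outer_mass_open_splits: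
  assumes S: "compact S" and L: "L \<in> states S" and U: "openin (top_of_set S) U" and E: "E \<subseteq> S"
  shows "outer_mass S L (E \<inter> U) + outer_mass S L (E - U) \<le> outer_mass S L E"
  unfolding outer_mass_def[of S L E]
proof (rule INF_greatest)
  fix V assume "V \<in> {V. openin (top_of_set S) V \<and> E \<subseteq> V}"
  then have V: "openin (top_of_set S) V" "E \<subseteq> V" by auto
  let ?M = "open_mass S L V"
  have *: "ennreal (L f) + outer_mass S L (E - U) \<le> ?M" if f: "f \<in> subordinate S (V \<inter> U)" for f
  proof (rule ennreal_le_epsilon)
    fix t :: real assume t: "0 < t"
    have fc: "continuous_on S f" and f0: "\<And>x. x \<in> S \<Longrightarrow> 0 \<le> f x"
      using f by (auto simp: subordinate_iff)
    let ?W = "V \<inter> {x \<in> S. f x < t}"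
    have "openin (top_of_set S) {x \<in> S. f x < t}"
      using continuous_openin_preimage_gen[OF fc, of "{..<t}"] by (simp add: vimage_def Int_def)
    then have W: "openin (top_of_set S) ?W" using V by (intro openin_Int)
    have "E - U \<subseteq> ?W"
    proof
      fix x assume x: "x \<in> E - U"
      then have "f x = 0" using f E by (auto simp: subordinate_iff)
      then show "x \<in> ?W" using x V E t by auto
    qed
    then have "outer_mass S L (E - U) \<le> open_mass S L ?W"
      using W by (intro outer_mass_lower)
    then have "ennreal (L f) + outer_mass S L (E - U) \<le> ennreal (L f) + open_mass S L ?W"
      by (rule add_left_mono)
    also have "\<dots> = (SUP g\<in>subordinate S ?W. ennreal (L f) + ennreal (L g))"
      unfolding open_mass_def using zero_subordinate by (intro ennreal_SUP_add_right) blast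
    also have "\<dots> \<le> ?M + ennreal t"
    proof (rule SUP_least)
      fix g assume g: "g \<in> subordinate S ?W"
      then have gc: "continuous_on S g" and g0: "\<And>x. x \<in> S \<Longrightarrow> 0 \<le> g x"
        by (auto simp: subordinate_iff)
      \<comment> \<open>Where \<open>g\<close> is nonzero, \<open>f < t\<close>, so the sum never exceeds
        \<open>1 + t\<close>.\<close>
      let ?k = "\<lambda>x. (1 / (1 + t)) * (f x + g x)"
      have "?k \<in> subordinate S V"
        unfolding subordinate_iff
      proof (intro conjI ballI)
        show "continuous_on S ?k" by (intro continuous_intros fc gc)
        fix x assume x: "x \<in> S"
        show "0 \<le> ?k x" using f0[OF x] g0[OF x] t by simp
        have "f x + g x \<le> 1 + t"
          using f g x t by (cases "f x < t") (auto simp: subordinate_iff intro: add_mono less_imp_le)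
        then show "?k x \<le> 1" using t by simp
        show "x \<notin> V \<longrightarrow> ?k x = 0"
          using f g x by (auto simp: subordinate_iff)
      qed
      then have "ennreal (L ?k) \<le> ?M" by (rule open_mass_upper)
      then have "ennreal (1 + t) * ennreal (L ?k) \<le> ennreal (1 + t) * ?M"
        by (rule mult_left_mono) simp
      also have "ennreal (1 + t) * ?M \<le> ?M + ennreal t"
        using t mult_left_mono[OF open_mass_le_1[OF L, of V], of "ennreal t"]
        by (simp add: distrib_right add_left_mono)
      also have "L ?k = (L f + L g) / (1 + t)"
        using fc gc by (subst states_cmult[OF L]) (auto simp: states_add[OF L] intro: continuous_intros)
      also have "ennreal (1 + t) * ennreal ((L f + L g) / (1 + t)) = ennreal (L f) + ennreal (L g)"
        using t states_nonneg[OF L fc f0] states_nonneg[OF L gc g0]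
        by (simp add: ennreal_mult'[symmetric] del: ennreal_plus flip: ennreal_plus)
      finally show "ennreal (L f) + ennreal (L g) \<le> ?M + ennreal t" .
    qed
    finally show "ennreal (L f) + outer_mass S L (E - U) \<le> ?M + ennreal t" .
  qed
  have "outer_mass S L (E \<inter> U) + outer_mass S L (E - U) \<le> open_mass S L (V \<inter> U) + outer_mass S L (E - U)"
    using V U by (intro add_right_mono outer_mass_lower openin_Int) auto
  also have "\<dots> = (SUP f\<in>subordinate S (V \<inter> U). ennreal (L f) + outer_mass S L (E - U))"
    unfolding open_mass_def using zero_subordinate by (intro ennreal_SUP_add_left[symmetric]) blast
  also have "\<dots> \<le> ?M"
    using * by (rule SUP_least)
  finally show "outer_mass S L (E \<inter> U) + outer_mass S L (E - U) \<le> ?M" .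
qed

lemma state_measure_on_open_sets:
  fixes S :: "'a::metric_space set"
  assumes S: "compact S" and L: "L \<in> states S"
  obtains M where "M \<in> borel_probs (top_of_set S)"
    and "\<And>U. openin (top_of_set S) U \<Longrightarrow> emeasure M U = open_mass S L U"
proof -
  let ?B = "sets (borel_of (top_of_set S))"
  interpret P: sigma_algebra S "Pow S" by (rule sigma_algebra_Pow)
  have om: "outer_measure_space (Pow S) (outer_mass S L)"
    by (rule outer_mass_outer_measure[OF S L])
  let ?C = "lambda_system S (Pow S) (outer_mass S L)"
  have ms: "measure_space S ?C (outer_mass S L)"
    by (rule P.caratheodory_lemma[OF om])
  have sub: "subadditive (Pow S) (outer_mass S L)"
    using om by (auto simp: outer_measure_space_def intro: P.countably_subadditive_subadditive)
  have "{U. openin (top_of_set S) U} \<subseteq> ?C"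
  proof (unfold P.lambda_system_eq, intro subsetI CollectI conjI ballI)
    fix U assume "U \<in> {U. openin (top_of_set S) U}"
    then have U: "openin (top_of_set S) U" by simp
    then show "U \<in> Pow S" using openin_imp_subset by blast
    fix E assume "E \<in> Pow S"
    then have E: "E \<subseteq> S" by simp
    have "outer_mass S L E \<le> outer_mass S L (E \<inter> U) + outer_mass S L (E - U)"
      using subadditiveD[OF sub, of "E \<inter> U" "E - U"] E
      by (simp add: Int_Diff_disjoint Int_Diff_Un le_infI1 Diff_subset_conv le_supI2)
    then show "outer_mass S L (E \<inter> U) + outer_mass S L (E - U) = outer_mass S L E"
      using outer_mass_open_splits[OF S L U E] by (rule antisym[rotated])
  qed
  then have BC: "?B \<subseteq> ?C"
    using ms unfolding sets_borel_of topspace_euclidean_subtopology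
    by (intro sigma_algebra.sigma_sets_subset) (auto simp: measure_space_def)
  define M where "M = measure_of S ?B (outer_mass S L)"
  have BS: "?B \<subseteq> Pow S"
    using sets.space_closed[of "borel_of (top_of_set S)"] by (simp add: space_borel_of)
  have sB: "sigma_sets S ?B = ?B"
    using sets.sigma_sets_eq[of "borel_of (top_of_set S)"] by (simp add: space_borel_of)
  have setsM: "sets M = ?B"
    using BS by (simp add: M_def sB)
  have "emeasure M A = outer_mass S L A" if "A \<in> ?B" for A
    unfolding M_def
  proof (rule emeasure_measure_of_sigma)
    show "sigma_algebra S ?B"
      using sets.sigma_algebra_axioms[of "borel_of (top_of_set S)"] by (simp add: space_borel_of)
    show "positive ?B (outer_mass S L)" "countably_additive ?B (outer_mass S L)"
      using ms BC unfolding measure_space_def positive_def countably_additive_def by blast+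
  qed fact
  then have em: "emeasure M U = open_mass S L U" if "openin (top_of_set S) U" for U
    using that by (simp add: outer_mass_open sets_borel_of sigma_sets.Basic)
  moreover have "space M = S"
    using setsM by (metis sets_eq_imp_space_eq space_borel_of topspace_euclidean_subtopology)
  then have "prob_space M"
    using em[of S] by (intro prob_spaceI) (simp add: open_mass_whole[OF L])
  ultimately show thesis
    using setsM by (intro that[of M]) (auto simp: borel_probs_def)
qed

lemma integrable_continuous_compact:
  fixes f :: "'a::metric_space \<Rightarrow> real"
  assumes S: "compact S" and M: "M \<in> borel_probs (top_of_set S)" and f: "continuous_on S f"
  shows "integrable M f"
proof -
  have "bounded (f ` S)"
    using S f compact_continuous_image compact_imp_bounded by blast
  then obtain B where "\<And>x. x \<in> S \<Longrightarrow> \<bar>f x\<bar> \<le> B"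
    by (auto simp: bounded_iff)
  then show ?thesis
    by (rule integrable_bounded_continuous[OF M f])
qed

text \<open>
  The function is cut into \<open>N\<close> horizontal slices of height \<open>1 / N\<close>. The functional of a slice is at
  most \<open>1 / N\<close> times the measure of the set where the slice is nonzero, and \<open>1 / N\<close> times the indicator
  of that set is dominated by the corresponding slice of \<open>f + 1 / N\<close>.
\<close>

lemma state_le_integral:
  fixes f :: "'a::metric_space \<Rightarrow> real"
  assumes S: "compact S" and L: "L \<in> states S" and M: "M \<in> borel_probs (top_of_set S)"
    and em: "\<And>U. openin (top_of_set S) U \<Longrightarrow> emeasure M U = open_mass S L U"
    and f: "continuous_on S f" and f01: "\<And>x. x \<in> S \<Longrightarrow> 0 \<le> f x \<and> f x \<le> 1"
  shows "L f \<le> (\<integral>x. f x \<partial>M)"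
proof (rule field_le_epsilon)
  interpret prob_space M using M by (simp add: borel_probs_def)
  have setsM: "sets M = sets (borel_of (top_of_set S))"
    using M by (simp add: borel_probs_def)
  have spM: "space M = S"
    using sets_eq_imp_space_eq[OF setsM] by (simp add: space_borel_of)
  fix e :: real assume "0 < e"
  then obtain n where n: "inverse (of_nat (Suc n)) < e" using reals_Archimedean by blast
  define N where "N = real (Suc n)"
  have N: "0 < N" "1 / N < e" using n by (auto simp: N_def inverse_eq_divide)
  define c where "c j = real j / N" for j
  have cS: "c (Suc j) = c j + 1 / N" for j by (simp add: c_def add_divide_distrib)
  define slice where "slice j x = min (f x) (c (Suc j)) - min (f x) (c j)" for j x
  \<comment> \<open>Slices of \<open>f + 1 / N\<close>: full wherever the slice of \<open>f\<close> at the
    same height has begun.\<close>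
  define up where "up j x = min (f x + 1 / N) (c (Suc j)) - min (f x + 1 / N) (c j)" for j x
  have cont: "continuous_on S (slice j)" "continuous_on S (up j)" for j
    unfolding slice_def up_def by (intro continuous_intros f)+
  have int: "integrable M (up j)" for j
    by (rule integrable_continuous_compact[OF S M cont(2)])
  have step: "L (slice j) \<le> (\<integral>x. up j x \<partial>M)" for j
  proof -
    let ?U = "{x \<in> S. c j < f x}"
    have U: "openin (top_of_set S) ?U"
      using continuous_openin_preimage_gen[OF f, of "{c j<..}"] by (simp add: vimage_def Int_def)
    then have Us[measurable]: "?U \<in> sets M" by (simp add: setsM sets_borel_of sigma_sets.Basic)
    have "0 \<le> N * slice j x \<and> N * slice j x \<le> 1 \<and> (x \<notin> ?U \<longrightarrow> N * slice j x = 0)" if "x \<in> S" for x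
    proof -
      have "0 < 1 / N" using N by simp
      moreover have "x \<notin> ?U \<Longrightarrow> f x \<le> c j" using that by auto
      ultimately have "0 \<le> slice j x" "slice j x \<le> 1 / N" "x \<notin> ?U \<Longrightarrow> slice j x = 0"
        unfolding slice_def cS by linarith+
      then show ?thesis using N by (auto simp: field_simps)
    qed
    then have "(\<lambda>x. N * slice j x) \<in> subordinate S ?U"
      using continuous_on_mult_left[OF cont(1)] by (simp add: subordinate_iff)
    then have "ennreal (L (\<lambda>x. N * slice j x)) \<le> emeasure M ?U"
      unfolding em[OF U] by (rule open_mass_upper)
    then have "N * L (slice j) \<le> measure M ?U"
      by (simp add: states_cmult[OF L cont(1)] emeasure_eq_measure)
    then have "L (slice j) \<le> (1 / N) * measure M ?U"
      using N by (simp add: field_simps)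
    also have "\<dots> = (\<integral>x. (1 / N) * indicator ?U x \<partial>M)"
      using sets.Int_space_eq2[OF Us] by simp
    also have "\<dots> \<le> (\<integral>x. up j x \<partial>M)"
    proof (rule integral_mono)
      show "integrable M (\<lambda>x. (1 / N) * indicator ?U x)"
        using Us by (intro integrable_mult_right integrable_real_indicator)
          (auto simp: emeasure_eq_measure)
      show "(1 / N) * indicator ?U x \<le> up j x" for x
      proof -
        have q: "0 < 1 / N" using N by simp
        show ?thesis
        proof (cases "x \<in> ?U")
          case True
          then have "c j < f x" by simp
          then show ?thesis
            using q unfolding up_def cS indicator_simps(1)[OF True] by linarith
        next
          case False
          then show ?thesis
            using q unfolding up_def cS indicator_simps(2)[OF False] by linarith
        qed
      qed
    qed (rule int)
    finally show ?thesis .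
  qed
  have tele: "(\<Sum>j<Suc n. min y (c (Suc j)) - min y (c j)) = min y 1 - min y 0" for y
    using sum_lessThan_telescope[of "\<lambda>j. min y (c j)" "Suc n"] N by (simp add: c_def N_def)
  have "L f = L (\<lambda>x. \<Sum>j<Suc n. slice j x)"
  proof (rule antisym; rule states_mono[OF L])
    fix x assume "x \<in> S"
    then show "f x \<le> (\<Sum>j<Suc n. slice j x)" "(\<Sum>j<Suc n. slice j x) \<le> f x"
      unfolding slice_def tele using f01 by (auto simp: min_def)
  qed (intro f continuous_on_sum cont)+
  also have "\<dots> = (\<Sum>j<Suc n. L (slice j))"
    by (rule states_sum[OF L]) (auto intro: cont)
  also have "\<dots> \<le> (\<Sum>j<Suc n. (\<integral>x. up j x \<partial>M))"
    by (intro sum_mono step)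
  also have "\<dots> = (\<integral>x. (\<Sum>j<Suc n. up j x) \<partial>M)"
    by (rule Bochner_Integration.integral_sum[symmetric]) (rule int)
  also have "\<dots> \<le> (\<integral>x. f x + 1 / N \<partial>M)"
  proof (rule integral_mono)
    show "integrable M (\<lambda>x. \<Sum>j<Suc n. up j x)" "integrable M (\<lambda>x. f x + 1 / N)"
      by (intro integrable_continuous_compact[OF S M] continuous_intros cont f)+
    fix x assume "x \<in> space M"
    then show "(\<Sum>j<Suc n. up j x) \<le> f x + 1 / N"
      unfolding up_def tele using f01[of x] N by (auto simp: spM min_def)
  qed
  also have "\<dots> = (\<integral>x. f x \<partial>M) + 1 / N"
    using integrable_continuous_compact[OF S M f] by (simp add: prob_space)
  finally show "L f \<le> (\<integral>x. f x \<partial>M) + e" using N by linarith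
qed

text \<open>
  The inequality of \<open>state_le_integral\<close>, applied to \<open>f\<close> and to \<open>1 - f\<close>, gives equality for functions
  with values in the unit interval; the general case is an affine change.
\<close>

theorem state_representation:
  fixes S :: "'a::metric_space set"
  assumes S: "compact S" and L: "L \<in> states S"
  obtains M where "M \<in> borel_probs (top_of_set S)"
    and "\<And>f. continuous_on S f \<Longrightarrow> L f = (\<integral>x. f x \<partial>M)"
proof -
  obtain M where M: "M \<in> borel_probs (top_of_set S)"
    and em: "\<And>U. openin (top_of_set S) U \<Longrightarrow> emeasure M U = open_mass S L U"
    using state_measure_on_open_sets[OF S L] by blast
  interpret prob_space M using M by (simp add: borel_probs_def)
  note int = integrable_continuous_compact[OF S M]
  have unit: "L f = (\<integral>x. f x \<partial>M)"
    if f: "continuous_on S f" and f01: "\<And>x. x \<in> S \<Longrightarrow> 0 \<le> f x \<and> f x \<le> 1" for f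
  proof (rule antisym)
    show "L f \<le> (\<integral>x. f x \<partial>M)"
      by (rule state_le_integral[OF S L M em f f01])
    have "L (\<lambda>x. 1 - f x) \<le> (\<integral>x. 1 - f x \<partial>M)"
      using f01 by (intro state_le_integral[OF S L M em] continuous_intros f) auto
    then show "(\<integral>x. f x \<partial>M) \<le> L f"
      using int[OF f] by (simp add: states_diff[OF L _ f] states_one[OF L] prob_space)
  qed
  have "L f = (\<integral>x. f x \<partial>M)" if f: "continuous_on S f" for f
  proof -
    have "bounded (f ` S)"
      using S f compact_continuous_image compact_imp_bounded by blast
    then obtain B where B: "0 < B" "\<And>x. x \<in> S \<Longrightarrow> \<bar>f x\<bar> \<le> B"
      by (auto simp: bounded_pos)
    let ?g = "\<lambda>x. 1 / (2 * B) * (f x + B)"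
    have "L ?g = (\<integral>x. ?g x \<partial>M)"
    proof (rule unit)
      show "continuous_on S ?g" by (intro continuous_intros f)
      show "0 \<le> ?g x \<and> ?g x \<le> 1" if "x \<in> S" for x
        using B(2)[OF that] B(1) by (auto simp: field_simps abs_le_iff)
    qed
    moreover have "L ?g = 1 / (2 * B) * (L f + B)"
      by (subst states_cmult[OF L continuous_on_add[OF f continuous_on_const]])
        (simp add: states_add[OF L f continuous_on_const] states_const[OF L])
    moreover have "(\<integral>x. ?g x \<partial>M) = 1 / (2 * B) * ((\<integral>x. f x \<partial>M) + B)"
    proof -
      have "(\<integral>x. ?g x \<partial>M) = 1 / (2 * B) * (\<integral>x. f x + B \<partial>M)"
        by (rule integral_mult_right_zero)
      then show ?thesis using int[OF f] by (simp add: prob_space)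
    qed
    ultimately show ?thesis using B(1) by simp
  qed
  with M show thesis using that by blast
qed

section \<open>The action on the unit sphere\<close>

lemma SL_vector_nonzero:
  fixes v :: "real^'n"
  assumes "A \<in> SL" "v \<noteq> 0"
  shows "A *v v \<noteq> 0"
proof
  assume "A *v v = 0"
  then have "(matrix_inv A ** A) *v v = 0"
    by (simp add: matrix_vector_mul_assoc[symmetric])
  then show False using SL_invertible[OF assms(1)] assms(2) by simp
qed

text \<open>
  Directions are represented by unit vectors rather than by lines: the sphere is a subset of a
  metric space, and a pair of measures that \<open>A\<close> matches on the sphere projects to such a pair on
  projective space.
\<close>

abbreviation usphere :: "(real^'n) set" where
  "usphere \<equiv> sphere 0 1"

definition dir_action :: "real^'n^'n \<Rightarrow> real^'n \<Rightarrow> real^'n" where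
  "dir_action A v = sgn (A *v v)"

lemma dir_action_sphere: "A \<in> SL \<Longrightarrow> v \<in> usphere \<Longrightarrow> dir_action A v \<in> usphere"
  using SL_vector_nonzero[of A v] by (cases "v = 0") (simp_all add: dir_action_def norm_sgn)

lemma continuous_on_dir_action:
  "continuous_on (SL \<times> usphere) (\<lambda>(A, v). dir_action A v)"
proof -
  have "continuous_on (SL \<times> usphere) (\<lambda>p :: (real^'n^'n) \<times> (real^'n). fst p *v snd p)"
    unfolding matrix_vector_mult_def
    by (intro continuous_on_vec_lambda continuous_intros continuous_on_component)
  then have "continuous_on (SL \<times> usphere) (\<lambda>p :: (real^'n^'n) \<times> (real^'n). sgn (fst p *v snd p))"
    unfolding sgn_div_norm
  proof (intro continuous_intros)
    have "A *v v \<noteq> 0" if "A \<in> SL" "v \<in> usphere" for A and v :: "real^'n"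
      using that by (intro SL_vector_nonzero) auto
    then show "\<forall>p\<in>SL \<times> usphere. norm (fst p *v snd p :: real^'n) \<noteq> 0" by force
  qed
  then show ?thesis
    by (simp add: dir_action_def case_prod_beta')
qed

lemma continuous_on_pullback:
  assumes "continuous_on usphere h"
  shows "continuous_on (SL \<times> usphere) (\<lambda>(A, v). h (dir_action A v))"
proof -
  have "continuous_on (SL \<times> usphere) (h \<circ> (\<lambda>(A, v). dir_action A v))"
    using dir_action_sphere
    by (intro continuous_on_compose continuous_on_dir_action continuous_on_subset[OF assms]) auto
  then show ?thesis by (simp add: o_def case_prod_beta')
qed

lemma continuous_on_pullback1:
  assumes "continuous_on usphere h" "A \<in> SL"
  shows "continuous_on usphere (\<lambda>v. h (dir_action A v))"
proof -
  have "continuous_on usphere (\<lambda>v. (\<lambda>(A, v). h (dir_action A v)) (A, v))"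
    using assms(2) by (intro continuous_on_compose2[OF continuous_on_pullback[OF assms(1)]] continuous_intros) auto
  then show ?thesis by simp
qed

lemma pullback_uniform_nbhd:
  fixes h :: "real^'n \<Rightarrow> real"
  assumes h: "continuous_on usphere h" and A: "A \<in> SL" and e: "0 < e"
  obtains T where "open T" "A \<in> T"
    "\<And>B L. B \<in> SL \<inter> T \<Longrightarrow> L \<in> states usphere \<Longrightarrow>
       \<bar>L (\<lambda>v. h (dir_action B v)) - L (\<lambda>v. h (dir_action A v))\<bar> \<le> e"
proof -
  obtain T where T: "A \<in> T" "open T"
    "\<forall>B\<in>T \<inter> SL. \<forall>v\<in>usphere. dist ((\<lambda>(A, v). h (dir_action A v)) (B, v)) ((\<lambda>(A, v). h (dir_action A v)) (A, v)) \<le> e"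
    by (rule continuous_on_prod_compactE[OF continuous_on_pullback[OF h] compact_sphere A e]) blast
  show thesis
  proof (rule that[OF T(2,1)])
    fix B and L :: "(real^'n \<Rightarrow> real) \<Rightarrow> real"
    assume B: "B \<in> SL \<inter> T" and L: "L \<in> states usphere"
    have c: "continuous_on usphere (\<lambda>v. h (dir_action B v))" "continuous_on usphere (\<lambda>v. h (dir_action A v))"
      using B A h by (auto intro: continuous_on_pullback1)
    show "\<bar>L (\<lambda>v. h (dir_action B v)) - L (\<lambda>v. h (dir_action A v))\<bar> \<le> e"
      unfolding states_diff[OF L c, symmetric]
      using T(3) B by (intro states_bound[OF L] continuous_intros c) (auto simp: dist_real_def)
  qed
qed

lemma continuous_on_state_pullback:
  fixes h :: "real^'n \<Rightarrow> real"
  assumes "continuous_on usphere h" and "L \<in> states usphere"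
  shows "continuous_on SL (\<lambda>A. L (\<lambda>v. h (dir_action A v)))"
proof (clarsimp simp: continuous_on_def tendsto_iff)
  fix A :: "real^'n^'n" and e :: real
  assume A: "A \<in> SL" and "0 < e"
  then have e2: "0 < e / 2" by simp
  obtain T where T: "open T" "A \<in> T"
    "\<And>B. B \<in> SL \<inter> T \<Longrightarrow> \<bar>L (\<lambda>v. h (dir_action B v)) - L (\<lambda>v. h (dir_action A v))\<bar> \<le> e / 2"
    by (rule pullback_uniform_nbhd[OF assms(1) A e2]) (use assms(2) in blast)
  have "\<bar>L (\<lambda>v. h (dir_action B v)) - L (\<lambda>v. h (dir_action A v))\<bar> < e" if "B \<in> SL \<inter> T" for B
    using T(3)[OF that] \<open>0 < e\<close> by linarith
  then show "\<forall>\<^sub>F B in at A within SL.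
      dist (L (\<lambda>v. h (dir_action B v))) (L (\<lambda>v. h (dir_action A v))) < e"
    using T(1,2) by (auto simp: eventually_at_topological dist_real_def)
qed

text \<open>
  For a fixed matrix this is continuity of one coordinate of the functional. Uniformity over \<open>C\<close>
  comes from a finite subcover: the pullbacks of \<open>h\<close> under matrices of \<open>C\<close> are totally bounded in the
  supremum norm.
\<close>

lemma state_pullback_nbhd:
  fixes h :: "real^'n \<Rightarrow> real"
  assumes h: "continuous_on usphere h" and C: "compact C" "C \<subseteq> SL"
    and L0: "L0 \<in> states usphere" and e: "0 < e"
  obtains V where "open V" "L0 \<in> V"
    "\<And>L A. L \<in> states usphere \<inter> V \<Longrightarrow> A \<in> C \<Longrightarrow>
       \<bar>L (\<lambda>v. h (dir_action A v)) - L0 (\<lambda>v. h (dir_action A v))\<bar> \<le> e"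
proof -
  let ?p = "\<lambda>A v. h (dir_action A v)"
  define uniform_at where "uniform_at A T \<longleftrightarrow> open T \<and> A \<in> T \<and>
      (\<forall>B L. B \<in> SL \<inter> T \<longrightarrow> L \<in> states usphere \<longrightarrow> \<bar>L (?p B) - L (?p A)\<bar> \<le> e / 3)" for A T
  have "\<forall>A\<in>C. \<exists>T. uniform_at A T"
  proof
    fix A assume "A \<in> C"
    then have A: "A \<in> SL" and e3: "0 < e / 3" using C e by auto
    obtain T where "open T" "A \<in> T"
      "\<And>B L. B \<in> SL \<inter> T \<Longrightarrow> L \<in> states usphere \<Longrightarrow> \<bar>L (?p B) - L (?p A)\<bar> \<le> e / 3"
      by (rule pullback_uniform_nbhd[OF h A e3]) blast
    then show "\<exists>T. uniform_at A T" by (auto simp: uniform_at_def)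
  qed
  then obtain T where T: "\<forall>A\<in>C. uniform_at A (T A)" by metis
  obtain F where F: "F \<subseteq> C" "finite F" "C \<subseteq> (\<Union>A\<in>F. T A)"
    by (rule compactE_image[OF C(1), of C T]) (use T in \<open>auto simp: uniform_at_def\<close>)
  define V where "V = (\<Inter>A\<in>F. {L. \<bar>L (?p A) - L0 (?p A)\<bar> < e / 3})"
  show thesis
  proof (rule that)
    show "open V"
      unfolding V_def using F(2)
      by (intro open_INT ballI open_Collect_less continuous_intros continuous_on_product_coordinates) auto
    show "L0 \<in> V" using e by (simp add: V_def)
    fix L A assume L: "L \<in> states usphere \<inter> V" and A: "A \<in> C"
    then obtain B where B: "B \<in> F" "A \<in> T B" using F(3) by auto
    then have BC: "B \<in> C" "A \<in> SL \<inter> T B" using F(1) A C(2) by auto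
    then have "\<bar>L (?p A) - L (?p B)\<bar> \<le> e / 3" "\<bar>L0 (?p A) - L0 (?p B)\<bar> \<le> e / 3"
      using T[rule_format, OF BC(1)] L L0 by (auto simp: uniform_at_def)
    moreover have "\<bar>L (?p B) - L0 (?p B)\<bar> < e / 3"
      using L B(1) by (simp add: V_def)
    ultimately show "\<bar>L (?p A) - L0 (?p A)\<bar> \<le> e" by linarith
  qed
qed

section \<open>Separating pairs of functionals, uniformly over a compact set of measures\<close>

lemma closed_SL: "closed (SL :: (real^'n^'n) set)"
  unfolding SL_def det_def
  by (intro closed_Collect_eq continuous_intros continuous_on_component)

text \<open>
  The cutoff confines attention to a compact set of matrices, over which the pullbacks of a test
  function are controlled uniformly.
\<close>

definition cutoff :: "real \<Rightarrow> real^'n^'n \<Rightarrow> real" where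
  "cutoff N A = max 0 (N - norm A)"

definition gap_density :: "((real^'n \<Rightarrow> real) \<Rightarrow> real) \<Rightarrow> ((real^'n \<Rightarrow> real) \<Rightarrow> real) \<Rightarrow>
    (real^'n \<Rightarrow> real) \<Rightarrow> real^'n^'n \<Rightarrow> real" where
  "gap_density L\<^sub>1 L\<^sub>2 h A = \<bar>L\<^sub>1 (\<lambda>v. h (dir_action A v)) - L\<^sub>2 h\<bar>"

text \<open>
  It vanishes for all test functions and cutoffs exactly when \<open>\<mu>\<close>-almost every matrix carries the
  measure of \<open>L\<^sub>1\<close> to the measure of \<open>L\<^sub>2\<close>.
\<close>

definition discrepancy :: "real \<Rightarrow> (real^'n^'n) measure \<Rightarrow> ((real^'n \<Rightarrow> real) \<Rightarrow> real) \<Rightarrow>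
    ((real^'n \<Rightarrow> real) \<Rightarrow> real) \<Rightarrow> (real^'n \<Rightarrow> real) \<Rightarrow> real" where
  "discrepancy N \<mu> L\<^sub>1 L\<^sub>2 h = (\<integral>A. cutoff N A * gap_density L\<^sub>1 L\<^sub>2 h A \<partial>\<mu>)"

definition unit_test :: "(real^'n \<Rightarrow> real) \<Rightarrow> bool" where
  "unit_test h \<longleftrightarrow> continuous_on usphere h \<and> (\<forall>v\<in>usphere. \<bar>h v\<bar> \<le> 1)"

lemma gap_density_bounds:
  assumes h: "unit_test h" and L: "L\<^sub>1 \<in> states usphere" "L\<^sub>2 \<in> states usphere" and A: "A \<in> SL"
  shows "0 \<le> gap_density L\<^sub>1 L\<^sub>2 h A" "gap_density L\<^sub>1 L\<^sub>2 h A \<le> 2"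
proof -
  have "\<bar>L\<^sub>1 (\<lambda>v. h (dir_action A v))\<bar> \<le> 1" "\<bar>L\<^sub>2 h\<bar> \<le> 1"
    using h A dir_action_sphere[OF A]
    by (auto simp: unit_test_def intro!: states_bound[OF L(1)] states_bound[OF L(2)] continuous_on_pullback1)
  then show "gap_density L\<^sub>1 L\<^sub>2 h A \<le> 2" by (simp add: gap_density_def)
qed (simp add: gap_density_def)

lemma cutoff_bounds: "0 \<le> N \<Longrightarrow> 0 \<le> cutoff N A \<and> cutoff N A \<le> N"
  by (auto simp: cutoff_def)

lemma continuous_on_gap_density:
  assumes "unit_test h" "L\<^sub>1 \<in> states usphere" "L\<^sub>2 \<in> states usphere"
  shows "continuous_on SL (gap_density L\<^sub>1 L\<^sub>2 h)"
  unfolding gap_density_def using assms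
  by (intro continuous_intros continuous_on_state_pullback) (auto simp: unit_test_def)

lemma cutoff_gap_density:
  assumes "unit_test h" "L\<^sub>1 \<in> states usphere" "L\<^sub>2 \<in> states usphere" "0 \<le> N"
  shows "continuous_on SL (\<lambda>A. cutoff N A * gap_density L\<^sub>1 L\<^sub>2 h A)"
    and "A \<in> SL \<Longrightarrow> \<bar>cutoff N A * gap_density L\<^sub>1 L\<^sub>2 h A\<bar> \<le> N * 2"
    and "\<mu> \<in> borel_probs (top_of_set SL) \<Longrightarrow> integrable \<mu> (\<lambda>A. cutoff N A * gap_density L\<^sub>1 L\<^sub>2 h A)"
proof -
  show c: "continuous_on SL (\<lambda>A. cutoff N A * gap_density L\<^sub>1 L\<^sub>2 h A)"
    unfolding cutoff_def using assms by (intro continuous_intros continuous_on_gap_density)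
  show b: "\<bar>cutoff N A * gap_density L\<^sub>1 L\<^sub>2 h A\<bar> \<le> N * 2" if "A \<in> SL" for A
    using cutoff_bounds[OF assms(4), of A] gap_density_bounds[OF assms(1-3) that]
    by (simp add: abs_mult mult_mono)
  show "integrable \<mu> (\<lambda>A. cutoff N A * gap_density L\<^sub>1 L\<^sub>2 h A)" if "\<mu> \<in> borel_probs (top_of_set SL)"
    by (rule integrable_bounded_continuous[OF that c b])
qed

lemma continuous_map_span_sphere:
  "continuous_map (top_of_set (usphere :: (real^'n) set)) proj_space (\<lambda>v. span {v})"
  using quotient_imp_continuous_map[OF quotient_map_proj_space]
  by (rule continuous_map_from_subtopology_mono) auto

lemma continuous_map_dir_action:
  fixes A :: "real^'n^'n"
  assumes "A \<in> SL"
  shows "continuous_map (top_of_set usphere) (top_of_set usphere) (dir_action A)"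
proof -
  have "continuous_on usphere (\<lambda>v. (\<lambda>(A, v). dir_action A v) (A, v))"
    using assms by (intro continuous_on_compose2[OF continuous_on_dir_action] continuous_intros) auto
  then show ?thesis
    using dir_action_sphere[OF assms] by auto
qed

lemma span_dir_action:
  assumes "A \<in> SL" "v \<in> usphere"
  shows "span {dir_action A v} = proj_map A (span {v})"
proof -
  have "A *v v \<noteq> 0" using assms by (intro SL_vector_nonzero) auto
  then have "span {sgn (A *v v)} = span {A *v v}"
    unfolding sgn_div_norm by (intro span_image_scale[of "{A *v v}" "\<lambda>_. inverse (norm (A *v v))", simplified]) auto
  then show ?thesis by (simp add: dir_action_def proj_map_span)
qed

text \<open>
  If all discrepancies vanish, then for each test function the two functionals match for almost
  every matrix. Applied to the countably many functions that approximate the indicators of a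
  determining family, this makes \<open>dir_action A\<close> carry the representing measure of \<open>L\<^sub>1\<close> to that of
  \<open>L\<^sub>2\<close> for almost every \<open>A\<close>, and the images under \<open>v \<mapsto> span {v}\<close> are a forbidden pair.
\<close>

proposition positive_discrepancy:
  fixes \<mu> :: "(real^'n^'n) measure"
  assumes \<mu>: "\<mu> \<in> borel_probs (top_of_set SL)"
    and no_pair: "\<not> (\<exists>\<nu>\<^sub>1 \<in> borel_probs proj_space. \<exists>\<nu>\<^sub>2 \<in> borel_probs proj_space.
           AE A in \<mu>. distr \<nu>\<^sub>1 (borel_of proj_space) (proj_map A) = \<nu>\<^sub>2)"
    and L: "L\<^sub>1 \<in> states usphere" "L\<^sub>2 \<in> states usphere"
  obtains h N where "unit_test h" "0 < N" "0 < discrepancy N \<mu> L\<^sub>1 L\<^sub>2 h"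
proof (rule ccontr)
  assume no: "\<not> thesis"
  note found = that
  have le0: "discrepancy N \<mu> L\<^sub>1 L\<^sub>2 h \<le> 0" if "unit_test h" "0 < N" for h N
    using found[OF that] no by force
  interpret \<mu>: prob_space \<mu> using \<mu> by (simp add: borel_probs_def)
  have sp: "space \<mu> = SL" using space_borel_probs[OF \<mu>] by simp
  have gap0: "AE A in \<mu>. gap_density L\<^sub>1 L\<^sub>2 h A = 0" if h: "unit_test h" for h
  proof -
    have "AE A in \<mu>. cutoff (real (Suc n)) A * gap_density L\<^sub>1 L\<^sub>2 h A = 0" for n
    proof -
      let ?F = "\<lambda>A. cutoff (real (Suc n)) A * gap_density L\<^sub>1 L\<^sub>2 h A"
      have nn: "AE A in \<mu>. 0 \<le> ?F A"
        using gap_density_bounds(1)[OF h L] cutoff_bounds[of "real (Suc n)"] sp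
        by (intro AE_I2 mult_nonneg_nonneg) auto
      have "(\<integral>A. ?F A \<partial>\<mu>) = 0"
        using le0[OF h, of "real (Suc n)"] integral_nonneg_AE[OF nn] by (simp add: discrepancy_def)
      then show ?thesis
        using integral_nonneg_eq_0_iff_AE[OF cutoff_gap_density(3)[OF h L _ \<mu>] nn] by simp
    qed
    then have "AE A in \<mu>. \<forall>n. cutoff (real (Suc n)) A * gap_density L\<^sub>1 L\<^sub>2 h A = 0"
      by (intro AE_all_countable[THEN iffD2] allI)
    then show ?thesis
    proof eventually_elim
      case (elim A)
      obtain n where "norm A < real n" using reals_Archimedean2 by blast
      then have "cutoff (real (Suc n)) A \<noteq> 0" by (simp add: cutoff_def)
      then show ?case using elim by auto
    qed
  qed
  obtain M\<^sub>1 where M\<^sub>1: "M\<^sub>1 \<in> borel_probs (top_of_set usphere)"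
    "\<And>f. continuous_on usphere f \<Longrightarrow> L\<^sub>1 f = (\<integral>x. f x \<partial>M\<^sub>1)"
    using state_representation[OF compact_sphere L(1)] by blast
  obtain M\<^sub>2 where M\<^sub>2: "M\<^sub>2 \<in> borel_probs (top_of_set usphere)"
    "\<And>f. continuous_on usphere f \<Longrightarrow> L\<^sub>2 f = (\<integral>x. f x \<partial>M\<^sub>2)"
    using state_representation[OF compact_sphere L(2)] by blast
  obtain \<U> :: "(real^'n) set set" where \<U>: "countable \<U>" "\<And>T. T \<in> \<U> \<Longrightarrow> open T"
    "\<And>M N. M \<in> borel_probs (top_of_set usphere) \<Longrightarrow> N \<in> borel_probs (top_of_set usphere) \<Longrightarrow>
       (\<And>T. T \<in> \<U> \<Longrightarrow> measure M (usphere \<inter> T) = measure N (usphere \<inter> T)) \<Longrightarrow> M = N"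
    using countable_determining_family by metis
  have "\<forall>T\<in>\<U>. \<exists>h :: nat \<Rightarrow> real^'n \<Rightarrow> real. (\<forall>k. continuous_on UNIV (h k)) \<and>
      (\<forall>k x. 0 \<le> h k x \<and> h k x \<le> 1) \<and> (\<forall>x. (\<lambda>k. h k x) \<longlonglongrightarrow> indicator T x)"
    using open_indicator_limit[OF \<U>(2)] by metis
  then obtain h :: "(real^'n) set \<Rightarrow> nat \<Rightarrow> real^'n \<Rightarrow> real" where h:
    "\<And>T k. T \<in> \<U> \<Longrightarrow> continuous_on UNIV (h T k)"
    "\<And>T k x. T \<in> \<U> \<Longrightarrow> 0 \<le> h T k x \<and> h T k x \<le> 1"
    "\<And>T x. T \<in> \<U> \<Longrightarrow> (\<lambda>k. h T k x) \<longlonglongrightarrow> indicator T x"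
    by metis
  have hc: "continuous_on usphere (h T k)" if "T \<in> \<U>" for T k
    using h(1)[OF that] continuous_on_subset by blast
  have ht: "unit_test (h T k)" if "T \<in> \<U>" for T k
    using hc[OF that] h(2)[OF that, of k] by (auto simp: unit_test_def abs_le_iff intro: order_trans[of _ 0])
  have "AE A in \<mu>. \<forall>T\<in>\<U>. \<forall>k. gap_density L\<^sub>1 L\<^sub>2 (h T k) A = 0"
    using gap0[OF ht] \<U>(1) by (simp add: AE_ball_countable AE_all_countable)
  then have "AE A in \<mu>. distr (distr M\<^sub>1 (borel_of proj_space) (\<lambda>v. span {v})) (borel_of proj_space) (proj_map A)
      = distr M\<^sub>2 (borel_of proj_space) (\<lambda>v. span {v})"
    using AE_space
  proof eventually_elim
    case (elim A)
    then have A: "A \<in> SL" by (simp add: sp)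
    define N where "N = distr M\<^sub>1 (borel_of (top_of_set usphere)) (dir_action A)"
    note act = distr_borel_probs[OF M\<^sub>1(1) continuous_map_dir_action[OF A]]
    have N: "N \<in> borel_probs (top_of_set usphere)"
      unfolding N_def by (rule act)
    have "measure N (usphere \<inter> T) = measure M\<^sub>2 (usphere \<inter> T)" if T: "T \<in> \<U>" for T
    proof (rule LIMSEQ_unique)
      show "(\<lambda>k. \<integral>x. h T k x \<partial>N) \<longlonglongrightarrow> measure N (usphere \<inter> T)"
        using h T by (intro integral_indicator_limit[OF N \<U>(2) hc]) auto
      have "(\<integral>x. h T k x \<partial>N) = (\<integral>x. h T k x \<partial>M\<^sub>2)" for k
      proof -
        have "(\<integral>x. h T k x \<partial>N) = (\<integral>v. h T k (dir_action A v) \<partial>M\<^sub>1)"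
          unfolding N_def
          using borel_measurable_continuous_on_restrict[OF hc[OF T, of k]] act(2)
          by (intro integral_distr) (auto simp: sets_borel_of_subtopology cong: measurable_cong_sets)
        also have "\<dots> = L\<^sub>1 (\<lambda>v. h T k (dir_action A v))"
          by (intro M\<^sub>1(2)[symmetric] continuous_on_pullback1 hc T A)
        also have "\<dots> = L\<^sub>2 (h T k)"
          using elim T by (simp add: gap_density_def)
        also have "\<dots> = (\<integral>x. h T k x \<partial>M\<^sub>2)"
          by (rule M\<^sub>2(2)[OF hc[OF T]])
        finally show ?thesis .
      qed
      then show "(\<lambda>k. \<integral>x. h T k x \<partial>N) \<longlonglongrightarrow> measure M\<^sub>2 (usphere \<inter> T)"
        using h T by (auto intro!: integral_indicator_limit[OF M\<^sub>2(1) \<U>(2) hc])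
    qed
    then have NM: "N = M\<^sub>2" by (intro \<U>(3) N M\<^sub>2(1))
    have "distr (distr M\<^sub>1 (borel_of proj_space) (\<lambda>v. span {v})) (borel_of proj_space) (proj_map A)
        = distr M\<^sub>1 (borel_of proj_space) (proj_map A \<circ> (\<lambda>v. span {v}))"
      by (rule distr_distr[OF measurable_proj_map[OF A] distr_borel_probs(2)[OF M\<^sub>1(1) continuous_map_span_sphere]])
    also have "\<dots> = distr M\<^sub>1 (borel_of proj_space) ((\<lambda>v. span {v}) \<circ> dir_action A)"
      using span_dir_action[OF A] space_borel_probs[OF M\<^sub>1(1)] by (intro distr_cong) auto
    also have "\<dots> = distr N (borel_of proj_space) (\<lambda>v. span {v})"
      unfolding N_def
      by (rule distr_distr[symmetric, OF measurable_continuous_map[OF continuous_map_span_sphere] act(2)])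
    finally show ?case by (simp add: NM)
  qed
  moreover have "distr M\<^sub>1 (borel_of proj_space) (\<lambda>v. span {v}) \<in> borel_probs proj_space"
    "distr M\<^sub>2 (borel_of proj_space) (\<lambda>v. span {v}) \<in> borel_probs proj_space"
    using M\<^sub>1(1) M\<^sub>2(1) continuous_map_span_sphere by (auto intro: distr_borel_probs)
  ultimately show False using no_pair by blast
qed

text \<open>
  Lower semicontinuity in all three arguments. The two functionals may move so little that
  the integrand decreases by at most \<open>\<eta> / 2\<close> at every matrix; after that only the fixed bounded continuous
  integrand of \<open>L\<^sub>1\<close> and \<open>L\<^sub>2\<close> is integrated against the moving measure.
\<close>

lemma discrepancy_nbhd:
  fixes \<mu> :: "(real^'n^'n) measure"
  assumes \<mu>: "\<mu> \<in> borel_probs (top_of_set SL)"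
    and L: "L\<^sub>1 \<in> states usphere" "L\<^sub>2 \<in> states usphere"
    and h: "unit_test h" and N: "0 < N" and c: "c < discrepancy N \<mu> L\<^sub>1 L\<^sub>2 h"
  obtains W V\<^sub>1 V\<^sub>2 where "openin (weak_topology (top_of_set SL)) W" "\<mu> \<in> W"
    "open V\<^sub>1" "L\<^sub>1 \<in> V\<^sub>1" "open V\<^sub>2" "L\<^sub>2 \<in> V\<^sub>2"
    "\<And>\<mu>' M\<^sub>1 M\<^sub>2. \<mu>' \<in> W \<Longrightarrow> M\<^sub>1 \<in> states usphere \<inter> V\<^sub>1 \<Longrightarrow> M\<^sub>2 \<in> states usphere \<inter> V\<^sub>2 \<Longrightarrow>
       c < discrepancy N \<mu>' M\<^sub>1 M\<^sub>2 h"
proof -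
  define \<eta> where "\<eta> = discrepancy N \<mu> L\<^sub>1 L\<^sub>2 h - c"
  define e where "e = \<eta> / (4 * N)"
  have \<eta>: "0 < \<eta>" and e: "0 < e" and Ne: "N * (2 * e) = \<eta> / 2"
    using c N by (simp_all add: \<eta>_def e_def)
  let ?C = "SL \<inter> cball 0 N :: (real^'n^'n) set"
  let ?F = "\<lambda>M\<^sub>1 M\<^sub>2 A. cutoff N A * gap_density M\<^sub>1 M\<^sub>2 h A"
  have hc: "continuous_on usphere h" using h by (simp add: unit_test_def)
  have C: "compact ?C" "?C \<subseteq> SL"
    using closed_Int_compact[OF closed_SL compact_cball] by auto
  obtain V\<^sub>1 where V\<^sub>1: "open V\<^sub>1" "L\<^sub>1 \<in> V\<^sub>1"
    "\<And>M A. M \<in> states usphere \<inter> V\<^sub>1 \<Longrightarrow> A \<in> ?C \<Longrightarrow>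
       \<bar>M (\<lambda>v. h (dir_action A v)) - L\<^sub>1 (\<lambda>v. h (dir_action A v))\<bar> \<le> e"
    by (rule state_pullback_nbhd[OF hc C L(1) e]) blast
  define V\<^sub>2 where "V\<^sub>2 = {M. \<bar>M h - L\<^sub>2 h\<bar> < e}"
  define W where "W = {\<mu>' \<in> borel_probs (top_of_set SL). (\<integral>A. ?F L\<^sub>1 L\<^sub>2 A \<partial>\<mu>') \<in> {c + \<eta> / 2 <..}}"
  have N0: "0 \<le> N" using N by simp
  note F = cutoff_gap_density[OF h _ _ N0]
  show thesis
  proof (rule that)
    show "openin (weak_topology (top_of_set SL)) W"
      unfolding W_def by (rule openin_weak_topology_integral[OF F(1)[OF L] F(2)[OF L]]) auto
    show "\<mu> \<in> W"
      using \<mu> \<eta> unfolding W_def \<eta>_def discrepancy_def by (auto simp: field_simps)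
    show "open V\<^sub>1" "L\<^sub>1 \<in> V\<^sub>1" by fact+
    show "open V\<^sub>2"
      unfolding V\<^sub>2_def by (intro open_Collect_less continuous_intros continuous_on_product_coordinates)
    show "L\<^sub>2 \<in> V\<^sub>2" using e by (simp add: V\<^sub>2_def)
    fix \<mu>' M\<^sub>1 M\<^sub>2
    assume \<mu>': "\<mu>' \<in> W" and M\<^sub>1: "M\<^sub>1 \<in> states usphere \<inter> V\<^sub>1" and M\<^sub>2: "M\<^sub>2 \<in> states usphere \<inter> V\<^sub>2"
    have b: "\<mu>' \<in> borel_probs (top_of_set SL)" using \<mu>' by (simp add: W_def)
    interpret prob_space \<mu>' using b by (simp add: borel_probs_def)
    have M: "M\<^sub>1 \<in> states usphere" "M\<^sub>2 \<in> states usphere" using M\<^sub>1 M\<^sub>2 by auto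
    have "?F L\<^sub>1 L\<^sub>2 A - \<eta> / 2 \<le> ?F M\<^sub>1 M\<^sub>2 A" if A: "A \<in> SL" for A
    proof (cases "norm A \<le> N")
      case True
      then have "\<bar>M\<^sub>1 (\<lambda>v. h (dir_action A v)) - L\<^sub>1 (\<lambda>v. h (dir_action A v))\<bar> \<le> e"
        using V\<^sub>1(3)[OF M\<^sub>1, of A] A by auto
      moreover have "\<bar>M\<^sub>2 h - L\<^sub>2 h\<bar> < e" using M\<^sub>2 by (simp add: V\<^sub>2_def)
      ultimately have "gap_density L\<^sub>1 L\<^sub>2 h A \<le> gap_density M\<^sub>1 M\<^sub>2 h A + 2 * e"
        unfolding gap_density_def by linarith
      then have "?F L\<^sub>1 L\<^sub>2 A \<le> cutoff N A * (gap_density M\<^sub>1 M\<^sub>2 h A + 2 * e)"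
        using cutoff_bounds[OF N0, of A] by (intro mult_left_mono) auto
      also have "\<dots> = ?F M\<^sub>1 M\<^sub>2 A + cutoff N A * (2 * e)" by (simp add: distrib_left)
      also have "cutoff N A * (2 * e) \<le> N * (2 * e)"
        using cutoff_bounds[OF N0, of A] e by (intro mult_right_mono) auto
      finally show ?thesis by (simp add: Ne)
    qed (use \<eta> in \<open>simp add: cutoff_def\<close>)
    then have "(\<integral>A. ?F L\<^sub>1 L\<^sub>2 A - \<eta> / 2 \<partial>\<mu>') \<le> (\<integral>A. ?F M\<^sub>1 M\<^sub>2 A \<partial>\<mu>')"
      using F(3)[OF L b] F(3)[OF M b] space_borel_probs[OF b]
      by (intro integral_mono) auto
    also have "(\<integral>A. ?F L\<^sub>1 L\<^sub>2 A - \<eta> / 2 \<partial>\<mu>') = (\<integral>A. ?F L\<^sub>1 L\<^sub>2 A \<partial>\<mu>') - \<eta> / 2"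
      using F(3)[OF L b] by (simp add: prob_space)
    finally show "c < discrepancy N \<mu>' M\<^sub>1 M\<^sub>2 h"
      using \<mu>' by (simp add: W_def discrepancy_def)
  qed
qed

definition separated :: "real \<Rightarrow> real \<Rightarrow> (real^'n^'n) measure \<Rightarrow> ((real^'n \<Rightarrow> real) \<Rightarrow> real) \<Rightarrow>
    ((real^'n \<Rightarrow> real) \<Rightarrow> real) \<Rightarrow> bool" where
  "separated N c \<mu> L\<^sub>1 L\<^sub>2 \<longleftrightarrow> (\<exists>h. unit_test h \<and> c < discrepancy N \<mu> L\<^sub>1 L\<^sub>2 h)"

lemma separated_mono:
  assumes "separated N c \<mu> L\<^sub>1 L\<^sub>2" and "\<mu> \<in> borel_probs (top_of_set SL)"
    and L: "L\<^sub>1 \<in> states usphere" "L\<^sub>2 \<in> states usphere" and N: "0 \<le> N" "N \<le> N'" and "c' \<le> c"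
  shows "separated N' c' \<mu> L\<^sub>1 L\<^sub>2"
proof -
  obtain h where h: "unit_test h" "c < discrepancy N \<mu> L\<^sub>1 L\<^sub>2 h"
    using assms(1) by (auto simp: separated_def)
  have "discrepancy N \<mu> L\<^sub>1 L\<^sub>2 h \<le> discrepancy N' \<mu> L\<^sub>1 L\<^sub>2 h"
    unfolding discrepancy_def
  proof (rule integral_mono)
    fix A assume "A \<in> space \<mu>"
    show "cutoff N A * gap_density L\<^sub>1 L\<^sub>2 h A \<le> cutoff N' A * gap_density L\<^sub>1 L\<^sub>2 h A"
      using N by (intro mult_right_mono) (auto simp: cutoff_def gap_density_def)
  qed (use N in \<open>auto intro!: cutoff_gap_density(3) h L assms(2)\<close>)
  then show ?thesis using h \<open>c' \<le> c\<close> by (auto simp: separated_def)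
qed

text \<open>
  Every triple of a measure in \<open>K\<close> and two functionals has a neighbourhood on which the separation
  is bounded below, and the set of all these triples is compact. Separation is monotone in \<open>N\<close> and \<open>c\<close>, so
  finitely many pairs of constants merge into one.
\<close>

proposition uniform_separation:
  fixes K :: "(real^'n^'n) measure set"
  assumes K: "compactin (weak_topology (top_of_set SL)) K"
    and no_pair: "\<forall>\<mu>\<in>K. \<not> (\<exists>\<nu>\<^sub>1 \<in> borel_probs proj_space. \<exists>\<nu>\<^sub>2 \<in> borel_probs proj_space.
           AE A in \<mu>. distr \<nu>\<^sub>1 (borel_of proj_space) (proj_map A) = \<nu>\<^sub>2)"
  obtains N c where "0 < N" "0 < c"
    "\<And>\<mu> L\<^sub>1 L\<^sub>2. \<mu> \<in> K \<Longrightarrow> L\<^sub>1 \<in> states usphere \<Longrightarrow> L\<^sub>2 \<in> states usphere \<Longrightarrow> separated N c \<mu> L\<^sub>1 L\<^sub>2"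
proof -
  let ?S = "states (usphere :: (real^'n) set)"
  let ?X = "prod_topology (weak_topology (top_of_set (SL :: (real^'n^'n) set)))
      (prod_topology (euclidean :: ((real^'n \<Rightarrow> real) \<Rightarrow> real) topology)
        (euclidean :: ((real^'n \<Rightarrow> real) \<Rightarrow> real) topology))"
  have Kb: "\<mu> \<in> borel_probs (top_of_set SL)" if "\<mu> \<in> K" for \<mu>
    using that compactin_subset_topspace[OF K] by (auto simp: topspace_weak_topology)
  define uniform where "uniform Q \<longleftrightarrow> (\<exists>N>0. \<exists>c>0. \<forall>\<mu> L\<^sub>1 L\<^sub>2. (\<mu>, L\<^sub>1, L\<^sub>2) \<in> Q \<inter> (K \<times> ?S \<times> ?S) \<longrightarrow>
      separated N c \<mu> L\<^sub>1 L\<^sub>2)" for Q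
  have uniform_empty: "uniform {}"
    unfolding uniform_def by (auto intro: gt_ex)
  have uniform_Un: "uniform (P \<union> Q)" if P: "uniform P" and Q: "uniform Q" for P Q
  proof -
    obtain N c where Nc: "0 < N" "0 < c"
      "\<And>\<mu> L\<^sub>1 L\<^sub>2. (\<mu>, L\<^sub>1, L\<^sub>2) \<in> P \<inter> (K \<times> ?S \<times> ?S) \<Longrightarrow> separated N c \<mu> L\<^sub>1 L\<^sub>2"
      using P unfolding uniform_def by auto
    obtain N' c' where Nc': "0 < N'" "0 < c'"
      "\<And>\<mu> L\<^sub>1 L\<^sub>2. (\<mu>, L\<^sub>1, L\<^sub>2) \<in> Q \<inter> (K \<times> ?S \<times> ?S) \<Longrightarrow> separated N' c' \<mu> L\<^sub>1 L\<^sub>2"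
      using Q unfolding uniform_def by auto
    have "separated (max N N') (min c c') \<mu> L\<^sub>1 L\<^sub>2"
      if m: "(\<mu>, L\<^sub>1, L\<^sub>2) \<in> (P \<union> Q) \<inter> (K \<times> ?S \<times> ?S)" for \<mu> L\<^sub>1 L\<^sub>2
    proof -
      have \<mu>: "\<mu> \<in> borel_probs (top_of_set SL)" and L: "L\<^sub>1 \<in> ?S" "L\<^sub>2 \<in> ?S"
        using m Kb by auto
      consider "separated N c \<mu> L\<^sub>1 L\<^sub>2" | "separated N' c' \<mu> L\<^sub>1 L\<^sub>2"
        using m Nc(3) Nc'(3) by blast
      then show ?thesis
        using Nc(1) Nc'(1) by cases (auto intro: separated_mono[OF _ \<mu> L])
    qed
    then show ?thesis
      using Nc Nc' unfolding uniform_def by (intro exI[of _ "max N N'"] exI[of _ "min c c'"] conjI) auto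
  qed
  have cov: "\<exists>Q. openin ?X Q \<and> uniform Q \<and> (\<mu>, L\<^sub>1, L\<^sub>2) \<in> Q"
    if \<mu>: "\<mu> \<in> K" and L: "L\<^sub>1 \<in> ?S" "L\<^sub>2 \<in> ?S" for \<mu> L\<^sub>1 L\<^sub>2
  proof -
    obtain h N where hN: "unit_test h" "0 < N" "0 < discrepancy N \<mu> L\<^sub>1 L\<^sub>2 h"
      using positive_discrepancy[OF Kb[OF \<mu>] _ L] no_pair \<mu> by blast
    define c where "c = discrepancy N \<mu> L\<^sub>1 L\<^sub>2 h / 2"
    have c: "0 < c" "c < discrepancy N \<mu> L\<^sub>1 L\<^sub>2 h" using hN by (simp_all add: c_def)
    obtain W V\<^sub>1 V\<^sub>2 where W: "openin (weak_topology (top_of_set SL)) W" "\<mu> \<in> W"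
      "open V\<^sub>1" "L\<^sub>1 \<in> V\<^sub>1" "open V\<^sub>2" "L\<^sub>2 \<in> V\<^sub>2"
      "\<And>\<mu>' M\<^sub>1 M\<^sub>2. \<mu>' \<in> W \<Longrightarrow> M\<^sub>1 \<in> states usphere \<inter> V\<^sub>1 \<Longrightarrow> M\<^sub>2 \<in> states usphere \<inter> V\<^sub>2 \<Longrightarrow>
         c < discrepancy N \<mu>' M\<^sub>1 M\<^sub>2 h"
      by (rule discrepancy_nbhd[OF Kb[OF \<mu>] L hN(1,2) c(2)]) blast
    have "uniform (W \<times> V\<^sub>1 \<times> V\<^sub>2)"
      unfolding uniform_def
    proof (intro exI conjI allI impI)
      show "separated N c \<mu>' M\<^sub>1 M\<^sub>2" if "(\<mu>', M\<^sub>1, M\<^sub>2) \<in> (W \<times> V\<^sub>1 \<times> V\<^sub>2) \<inter> (K \<times> ?S \<times> ?S)" for \<mu>' M\<^sub>1 M\<^sub>2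
        using W(7)[of \<mu>' M\<^sub>1 M\<^sub>2] that hN(1) unfolding separated_def by blast
    qed fact+
    moreover have "openin ?X (W \<times> V\<^sub>1 \<times> V\<^sub>2)"
      using W by (simp add: openin_prod_Times_iff open_Times)
    ultimately show ?thesis using W by blast
  qed
  have "compactin ?X (K \<times> ?S \<times> ?S)"
    using K compact_states[OF compact_sphere[of "0 :: real^'n" 1]]
    by (simp only: compactin_Times compactin_euclidean_iff simp_thms)
  moreover have "K \<times> ?S \<times> ?S \<subseteq> \<Union>{Q. openin ?X Q \<and> uniform Q}"
    using cov by blast
  ultimately obtain \<F> where \<F>: "finite \<F>" "\<F> \<subseteq> {Q. openin ?X Q \<and> uniform Q}" "K \<times> ?S \<times> ?S \<subseteq> \<Union>\<F>"
    using compactinD[of ?X "K \<times> ?S \<times> ?S" "{Q. openin ?X Q \<and> uniform Q}"] by auto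
  from \<F>(1,2) have "uniform (\<Union>\<F>)"
    by (induction rule: finite_induct) (auto simp: uniform_empty intro: uniform_Un)
  then obtain N c where "0 < N" "0 < c"
    "\<And>\<mu> L\<^sub>1 L\<^sub>2. (\<mu>, L\<^sub>1, L\<^sub>2) \<in> \<Union>\<F> \<inter> (K \<times> ?S \<times> ?S) \<Longrightarrow> separated N c \<mu> L\<^sub>1 L\<^sub>2"
    unfolding uniform_def by auto
  then show thesis using \<F>(3) by (intro that[of N c]) blast+
qed

section \<open>Densities on Euclidean space and their overlap\<close>

lemma abs_mult_le_sum_squares: "\<bar>a * b\<bar> \<le> a\<^sup>2 + b\<^sup>2" for a b :: real
proof -
  have "0 \<le> \<bar>a * b\<bar>" "2 * \<bar>a * b\<bar> \<le> a\<^sup>2 + b\<^sup>2"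
    using sum_squares_bound[of "\<bar>a\<bar>" "\<bar>b\<bar>"] by (simp_all add: abs_mult mult.assoc)
  then show ?thesis by linarith
qed

text \<open>
  The homogeneous extension of degree zero.
\<close>

definition radial :: "(real^'n \<Rightarrow> real) \<Rightarrow> real^'n \<Rightarrow> real" where
  "radial h x = (if x = 0 then 0 else h (sgn x))"

text \<open>
  For \<open>g\<close> of norm one this is integration against the radial projection to the sphere of the
  probability measure with density \<open>g\<^sup>2\<close>.
\<close>

definition density_state :: "(real^'n \<Rightarrow> real) \<Rightarrow> (real^'n \<Rightarrow> real) \<Rightarrow> real" where
  "density_state g h = (if continuous_on usphere h
     then \<integral>x. radial h x * (g x)\<^sup>2 \<partial>lborel else 0)"

lemma radial_measurable:
  fixes h :: "real^'n \<Rightarrow> real"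
  assumes "continuous_on usphere h"
  shows "radial h \<in> borel_measurable borel"
proof -
  have "continuous_on (- {0}) (\<lambda>x :: real^'n. sgn x)"
    unfolding sgn_div_norm by (intro continuous_intros) auto
  then have "continuous_on (- {0}) (\<lambda>x. h (sgn x))"
    by (rule continuous_on_compose2[OF assms]) (auto simp: norm_sgn split: if_splits)
  then have "(\<lambda>x. indicator (- {0}) x *\<^sub>R h (sgn x)) \<in> borel_measurable borel"
    by (intro borel_measurable_continuous_on_indicator) auto
  moreover have "radial h = (\<lambda>x. indicator (- {0}) x *\<^sub>R h (sgn x))"
    by (auto simp: radial_def fun_eq_iff)
  ultimately show ?thesis by simp
qed

lemma radial_bound:
  assumes "\<And>v. v \<in> usphere \<Longrightarrow> \<bar>h v\<bar> \<le> B" and "0 \<le> B"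
  shows "\<bar>radial h x\<bar> \<le> (B :: real)"
  using assms(1)[of "sgn x"] assms(2) by (cases "x = 0") (auto simp: norm_sgn radial_def)

lemma radial_integrable:
  fixes h :: "real^'n \<Rightarrow> real"
  assumes h: "continuous_on usphere h"
    and g: "g \<in> borel_measurable borel" "integrable lborel (\<lambda>x. (g x)\<^sup>2)"
  shows "integrable lborel (\<lambda>x. radial h x * (g x)\<^sup>2)"
proof -
  have "bounded (h ` usphere)"
    using h compact_continuous_image compact_imp_bounded compact_sphere by blast
  then obtain B where B: "0 < B" "\<And>v. v \<in> usphere \<Longrightarrow> \<bar>h v\<bar> \<le> B"
    by (auto simp: bounded_pos)
  show ?thesis
  proof (rule Bochner_Integration.integrable_bound)
    show "integrable lborel (\<lambda>x. B * (g x)\<^sup>2)" using g by simp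
    show "(\<lambda>x. radial h x * (g x)\<^sup>2) \<in> borel_measurable lborel"
      using radial_measurable[OF h] g(1) by measurable
    show "AE x in lborel. norm (radial h x * (g x)\<^sup>2) \<le> norm (B * (g x)\<^sup>2)"
    proof (rule AE_I2)
      fix x
      have "\<bar>radial h x\<bar> \<le> B" using radial_bound[OF B(2)] B(1) by auto
      then show "norm (radial h x * (g x)\<^sup>2) \<le> norm (B * (g x)\<^sup>2)"
        using B(1) by (simp add: abs_mult mult_right_mono)
    qed
  qed
qed

lemma density_state_in_states:
  fixes g :: "real^'n \<Rightarrow> real"
  assumes g: "g \<in> borel_measurable borel" "integrable lborel (\<lambda>x. (g x)\<^sup>2)" "(\<integral>x. (g x)\<^sup>2 \<partial>lborel) = 1"
  shows "density_state g \<in> states usphere"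
proof -
  note int = radial_integrable[OF _ g(1,2)]
  have "density_state g (\<lambda>x. f x + h x) = density_state g f + density_state g h"
    if "continuous_on usphere f" "continuous_on usphere h" for f h
  proof -
    have "radial (\<lambda>x. f x + h x) x * (g x)\<^sup>2 = radial f x * (g x)\<^sup>2 + radial h x * (g x)\<^sup>2" for x
      by (simp add: radial_def distrib_right)
    then show ?thesis
      using that int[OF that(1)] int[OF that(2)] by (simp add: density_state_def continuous_on_add)
  qed
  moreover have "density_state g (\<lambda>x. c * f x) = c * density_state g f" if "continuous_on usphere f" for c f
  proof -
    have "radial (\<lambda>x. c * f x) = (\<lambda>x. c * radial f x)"
      by (auto simp: radial_def)
    then show ?thesis
      using that by (simp add: density_state_def continuous_on_mult_left mult.assoc)
  qed
  moreover have "0 \<le> density_state g f" if "continuous_on usphere f" "\<forall>x\<in>usphere. 0 \<le> f x" for f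
  proof -
    have "0 \<le> radial f x * (g x)\<^sup>2" for x
      using that(2) by (auto simp: norm_sgn radial_def)
    then show ?thesis
      using that(1) by (simp add: density_state_def Bochner_Integration.integral_nonneg)
  qed
  moreover have "density_state g (\<lambda>_. 1) = 1"
  proof -
    have "(\<integral>x. radial (\<lambda>_. 1) x * (g x)\<^sup>2 \<partial>lborel) = (\<integral>x. (g x)\<^sup>2 \<partial>lborel)"
    proof (rule integral_cong_AE)
      show "AE x in lborel. radial (\<lambda>_. 1) x * (g x)\<^sup>2 = (g x)\<^sup>2"
        using AE_lborel_singleton[of "0 :: real^'n"] by eventually_elim (simp add: radial_def)
      show "(\<lambda>x. radial (\<lambda>_. 1) x * (g x)\<^sup>2) \<in> borel_measurable lborel"
        using radial_measurable[of "\<lambda>_. 1"] g(1) by measurable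
    qed (use g(1) in measurable)
    then show ?thesis using g(3) by (simp add: density_state_def)
  qed
  ultimately show ?thesis
    by (auto simp: states_def density_state_def)
qed

lemma SL_substitution:
  fixes F :: "real^'n \<Rightarrow> real"
  assumes A: "A \<in> SL" and F: "F \<in> borel_measurable borel"
  shows "(\<integral>x. F (A *v x) \<partial>lborel) = (\<integral>x. F x \<partial>lborel)"
    and "integrable lborel F \<Longrightarrow> integrable lborel (\<lambda>x. F (A *v x))"
proof -
  show "(\<integral>x. F (A *v x) \<partial>lborel) = (\<integral>x. F x \<partial>lborel)"
    using integral_distr[of "(*v) A" lborel borel F] F distr_lborel_SL[OF A] by simp
  show "integrable lborel (\<lambda>x. F (A *v x))" if "integrable lborel F"
    using integrable_distr[of "(*v) A" lborel borel F] that distr_lborel_SL[OF A] by simp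
qed

lemma radial_pullback:
  fixes x :: "real^'n"
  assumes "A \<in> SL"
  shows "radial (\<lambda>v. h (dir_action A v)) x = radial h (A *v x)"
proof (cases "x = 0")
  case False
  have "A *v sgn x = inverse (norm x) *\<^sub>R (A *v x)"
    by (simp add: sgn_div_norm matrix_vector_mult_scaleR)
  then have "dir_action A (sgn x) = sgn (A *v x)"
    using False by (simp add: dir_action_def sgn_scaleR)
  then show ?thesis
    using False SL_vector_nonzero[OF assms False] by (simp add: radial_def)
qed (simp add: radial_def)

text \<open>
  Invariance of Lebesgue measure turns the difference of the two functionals into an integral of
  \<open>g\<^sup>2 - F\<^sup>2\<close> against a function bounded by one, where \<open>F = f \<circ> A\<close>. This difference is
  \<open>(g - F) * (g + F)\<close>, and the weighted arithmetic-geometric mean inequality bounds its absolute value by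
  \<open>(g - F)\<^sup>2 / (2 * \<eta>) + \<eta> * (g + F)\<^sup>2 / 2\<close>. The overlap enters through the first square.
\<close>

lemma gap_density_le_overlap:
  fixes f g :: "real^'n \<Rightarrow> real"
  assumes f: "f \<in> borel_measurable borel" "integrable lborel (\<lambda>x. (f x)\<^sup>2)" "(\<integral>x. (f x)\<^sup>2 \<partial>lborel) = 1"
    and g: "g \<in> borel_measurable borel" "integrable lborel (\<lambda>x. (g x)\<^sup>2)" "(\<integral>x. (g x)\<^sup>2 \<partial>lborel) = 1"
    and h: "unit_test h" and A: "A \<in> SL" and \<eta>: "0 < \<eta>"
  shows "gap_density (density_state g) (density_state f) h A
    \<le> (1 - (\<integral>x. f (A *v x) * g x \<partial>lborel)) / \<eta> + 2 * \<eta>"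
proof -
  let ?H = "\<lambda>x. radial h (A *v x)"
  let ?F = "\<lambda>x. f (A *v x)"
  have hc: "continuous_on usphere h" and h1: "\<And>v. v \<in> usphere \<Longrightarrow> \<bar>h v\<bar> \<le> 1"
    using h by (auto simp: unit_test_def)
  have F: "?F \<in> borel_measurable borel" using f(1) by measurable
  have f2: "(\<lambda>x. (f x)\<^sup>2) \<in> borel_measurable borel" using f(1) by measurable
  have F2: "integrable lborel (\<lambda>x. (?F x)\<^sup>2)" "(\<integral>x. (?F x)\<^sup>2 \<partial>lborel) = 1"
    using SL_substitution[OF A f2] f by auto
  have Fg: "integrable lborel (\<lambda>x. ?F x * g x)"
  proof (rule Bochner_Integration.integrable_bound)
    show "integrable lborel (\<lambda>x. (?F x)\<^sup>2 + (g x)\<^sup>2)" using F2 g by simp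
    show "AE x in lborel. norm (?F x * g x) \<le> norm ((?F x)\<^sup>2 + (g x)\<^sup>2)"
      by (intro AE_I2) (simp add: abs_mult_le_sum_squares)
  qed (use F g(1) in measurable)
  note ih = radial_integrable[OF hc]
  have m: "(\<lambda>x. radial h x * (f x)\<^sup>2) \<in> borel_measurable borel"
    using radial_measurable[OF hc] f(1) by measurable
  have "density_state g (\<lambda>v. h (dir_action A v)) = (\<integral>x. ?H x * (g x)\<^sup>2 \<partial>lborel)"
    unfolding density_state_def radial_pullback[OF A]
    using continuous_on_pullback1[OF hc A] by simp
  moreover have "density_state f h = (\<integral>x. ?H x * (?F x)\<^sup>2 \<partial>lborel)"
    using SL_substitution(1)[OF A m] hc by (simp add: density_state_def)
  moreover have Hg: "integrable lborel (\<lambda>x. ?H x * (g x)\<^sup>2)"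
    using radial_integrable[OF continuous_on_pullback1[OF hc A] g(1,2)]
    by (simp only: radial_pullback[OF A])
  moreover have HF: "integrable lborel (\<lambda>x. ?H x * (?F x)\<^sup>2)"
    using SL_substitution(2)[OF A m] ih[OF f(1,2)] by simp
  ultimately have "gap_density (density_state g) (density_state f) h A =
      \<bar>\<integral>x. ?H x * (g x)\<^sup>2 - ?H x * (?F x)\<^sup>2 \<partial>lborel\<bar>"
    unfolding gap_density_def by (simp only: Bochner_Integration.integral_diff)
  also have "\<dots> \<le> (\<integral>x. ((?F x)\<^sup>2 + (g x)\<^sup>2 - 2 * (?F x * g x)) / (2 * \<eta>) + \<eta> * ((?F x)\<^sup>2 + (g x)\<^sup>2) \<partial>lborel)"
  proof (rule integral_abs_bound[THEN order_trans], rule integral_mono)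
    show "integrable lborel (\<lambda>x. \<bar>?H x * (g x)\<^sup>2 - ?H x * (?F x)\<^sup>2\<bar>)"
      using Hg HF by simp
    show "integrable lborel (\<lambda>x. ((?F x)\<^sup>2 + (g x)\<^sup>2 - 2 * (?F x * g x)) / (2 * \<eta>) + \<eta> * ((?F x)\<^sup>2 + (g x)\<^sup>2))"
      using F2 g(2) Fg by simp
    fix x
    have "\<bar>?H x\<bar> \<le> 1" using radial_bound[OF h1, where x = "A *v x"] by simp
    then have "\<bar>?H x\<bar> * \<bar>(g x)\<^sup>2 - (?F x)\<^sup>2\<bar> \<le> 1 * \<bar>(g x)\<^sup>2 - (?F x)\<^sup>2\<bar>"
      by (intro mult_right_mono) auto
    then have "\<bar>?H x * (g x)\<^sup>2 - ?H x * (?F x)\<^sup>2\<bar> \<le> \<bar>(g x)\<^sup>2 - (?F x)\<^sup>2\<bar>"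
      by (simp only: right_diff_distrib[symmetric] abs_mult) simp
    also have "\<dots> \<le> ((?F x)\<^sup>2 + (g x)\<^sup>2 - 2 * (?F x * g x)) / (2 * \<eta>) + \<eta> * ((?F x)\<^sup>2 + (g x)\<^sup>2)"
    proof -
      define p q where "p = \<bar>g x - ?F x\<bar>" and "q = \<bar>g x + ?F x\<bar>"
      have "0 \<le> (p - \<eta> * q)\<^sup>2" by simp
      then have "p * q * (2 * \<eta>) \<le> p\<^sup>2 + \<eta>\<^sup>2 * q\<^sup>2"
        by (simp add: power2_eq_square algebra_simps)
      then have "p * q \<le> p\<^sup>2 / (2 * \<eta>) + \<eta> * (q\<^sup>2 / 2)"
        using \<eta> by (simp add: field_simps power2_eq_square)
      moreover have "p * q = \<bar>(g x)\<^sup>2 - (?F x)\<^sup>2\<bar>"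
        by (simp add: p_def q_def power2_eq_square algebra_simps flip: abs_mult)
      moreover have "p\<^sup>2 = (?F x)\<^sup>2 + (g x)\<^sup>2 - 2 * (?F x * g x)"
        by (simp add: p_def power2_eq_square algebra_simps)
      moreover have "q\<^sup>2 / 2 \<le> (?F x)\<^sup>2 + (g x)\<^sup>2"
        using sum_squares_bound[of "?F x" "g x"] by (simp add: q_def power2_eq_square algebra_simps)
      then have "\<eta> * (q\<^sup>2 / 2) \<le> \<eta> * ((?F x)\<^sup>2 + (g x)\<^sup>2)"
        using \<eta> by (intro mult_left_mono) auto
      ultimately show ?thesis by simp
    qed
    finally show "\<bar>?H x * (g x)\<^sup>2 - ?H x * (?F x)\<^sup>2\<bar> \<le>
      ((?F x)\<^sup>2 + (g x)\<^sup>2 - 2 * (?F x * g x)) / (2 * \<eta>) + \<eta> * ((?F x)\<^sup>2 + (g x)\<^sup>2)" .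
  qed
  also have "\<dots> = (1 - (\<integral>x. ?F x * g x \<partial>lborel)) / \<eta> + 2 * \<eta>"
  proof -
    have "\<dots> = (\<integral>x. ((?F x)\<^sup>2 + (g x)\<^sup>2 - 2 * (?F x * g x)) / (2 * \<eta>) \<partial>lborel)
        + (\<integral>x. \<eta> * ((?F x)\<^sup>2 + (g x)\<^sup>2) \<partial>lborel)"
      using F2 g Fg by (intro Bochner_Integration.integral_add) auto
    also have "(\<integral>x. \<eta> * ((?F x)\<^sup>2 + (g x)\<^sup>2) \<partial>lborel) = 2 * \<eta>"
      using F2 g by simp
    also have "(\<integral>x. ((?F x)\<^sup>2 + (g x)\<^sup>2 - 2 * (?F x * g x)) / (2 * \<eta>) \<partial>lborel) =
        (2 - 2 * (\<integral>x. ?F x * g x \<partial>lborel)) / (2 * \<eta>)"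
      unfolding integral_divide_zero using F2 g Fg by simp
    finally show ?thesis using \<eta> by (simp add: field_simps)
  qed
  finally show ?thesis .
qed

section \<open>Averaging over the random matrix contracts square integrable functions\<close>

lemma matrix_id_measurable:
  fixes \<mu> :: "(real^'n^'n) measure"
  assumes "\<mu> \<in> borel_probs (top_of_set SL)"
  shows "(\<lambda>A. A) \<in> \<mu> \<rightarrow>\<^sub>M borel"
proof -
  have "sets \<mu> = sets (restrict_space borel SL)"
    using assms by (simp add: borel_probs_def sets_borel_of_subtopology)
  moreover have "(\<lambda>A. A) \<in> restrict_space borel SL \<rightarrow>\<^sub>M borel"
    by (intro measurable_restrict_space1) simp
  ultimately show ?thesis by (simp cong: measurable_cong_sets)
qed

lemma action_measurable:
  fixes T :: "'a \<Rightarrow> real^'n^'n" and f :: "real^'n \<Rightarrow> real"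
  assumes T: "T \<in> M \<rightarrow>\<^sub>M borel" and f: "f \<in> borel_measurable borel"
  shows "(\<lambda>(\<omega>, x). f (T \<omega> *v x)) \<in> borel_measurable (M \<Otimes>\<^sub>M lborel)"
proof -
  have "continuous_on UNIV (\<lambda>p :: (real^'n^'n) \<times> (real^'n). fst p *v snd p)"
    unfolding matrix_vector_mult_def
    by (intro continuous_on_vec_lambda continuous_intros continuous_on_component)
  then have 1: "(\<lambda>p :: (real^'n^'n) \<times> (real^'n). fst p *v snd p) \<in> borel \<Otimes>\<^sub>M borel \<rightarrow>\<^sub>M borel"
    unfolding borel_prod by (rule borel_measurable_continuous_onI)
  have 2: "(\<lambda>p. (T (fst p), snd p)) \<in> M \<Otimes>\<^sub>M lborel \<rightarrow>\<^sub>M (borel :: (real^'n^'n) measure) \<Otimes>\<^sub>M (borel :: (real^'n) measure)"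
    by (intro measurable_Pair measurable_compose[OF measurable_fst T])
      (use measurable_snd[of M lborel] in simp)
  have "(\<lambda>p. T (fst p) *v snd p) \<in> M \<Otimes>\<^sub>M lborel \<rightarrow>\<^sub>M borel"
    using measurable_compose[OF 2 1] by simp
  from measurable_compose[OF this f] show ?thesis
    by (simp add: case_prod_beta')
qed

text \<open>
  Values in the unit interval keep all averages over matrices integrable; the class contains the
  indicator of the unit ball and is preserved by averaging.
\<close>

definition profile :: "(real^'n \<Rightarrow> real) \<Rightarrow> bool" where
  "profile f \<longleftrightarrow> f \<in> borel_measurable borel \<and> (\<forall>x. 0 \<le> f x \<and> f x \<le> 1) \<and> integrable lborel (\<lambda>x. (f x)\<^sup>2)"

definition transfer :: "(real^'n^'n) measure \<Rightarrow> (real^'n \<Rightarrow> real) \<Rightarrow> real^'n \<Rightarrow> real" where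
  "transfer \<mu> f x = (\<integral>A. f (A *v x) \<partial>\<mu>)"

lemma transfer_props:
  fixes \<mu> :: "(real^'n^'n) measure"
  assumes \<mu>: "\<mu> \<in> borel_probs (top_of_set SL)" and f: "profile f"
  shows "profile (transfer \<mu> f)"
    and "(\<integral>A. (\<integral>x. f (A *v x) * transfer \<mu> f x \<partial>lborel) \<partial>\<mu>) = (\<integral>x. (transfer \<mu> f x)\<^sup>2 \<partial>lborel)"
    and "integrable \<mu> (\<lambda>A. \<integral>x. f (A *v x) * transfer \<mu> f x \<partial>lborel)"
    and "(\<integral>x. (transfer \<mu> f x)\<^sup>2 \<partial>lborel) \<le> (\<integral>x. (f x)\<^sup>2 \<partial>lborel)"
proof -
  interpret \<mu>: prob_space \<mu> using \<mu> by (simp add: borel_probs_def)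
  interpret pair_sigma_finite \<mu> "lborel :: (real^'n) measure" ..
  have sp: "space \<mu> = SL" using space_borel_probs[OF \<mu>] by simp
  have fm: "f \<in> borel_measurable borel" and f01: "\<And>x. 0 \<le> f x" "\<And>x. f x \<le> 1"
    and f2: "integrable lborel (\<lambda>x. (f x)\<^sup>2)"
    using f by (auto simp: profile_def)
  let ?P = "transfer \<mu> f"
  have f2m: "(\<lambda>x. (f x)\<^sup>2) \<in> borel_measurable borel" using fm by measurable
  note am[measurable] = action_measurable[OF matrix_id_measurable[OF \<mu>] fm]
  note am2[measurable] = action_measurable[OF matrix_id_measurable[OF \<mu>] f2m]
  have sec: "(\<lambda>A. f (A *v x)) \<in> borel_measurable \<mu>" for x
    using measurable_compose[OF measurable_Pair2'[of x lborel \<mu>] am] by simp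
  have secint: "integrable \<mu> (\<lambda>A. f (A *v x))" for x
    using sec f01 by (intro \<mu>.integrable_const_bound[of _ 1]) auto
  have secint2: "integrable \<mu> (\<lambda>A. (f (A *v x))\<^sup>2)" for x
    using sec f01 by (intro \<mu>.integrable_const_bound[of _ 1]) (auto simp: power_le_one)
  have Pm[measurable]: "?P \<in> borel_measurable borel"
  proof -
    have "(\<lambda>(x, A). f (A *v x)) \<in> borel_measurable (lborel \<Otimes>\<^sub>M \<mu>)"
      using measurable_pair_swap[OF am] by (simp add: case_prod_beta')
    then have "(\<lambda>x. \<integral>A. f (A *v x) \<partial>\<mu>) \<in> borel_measurable lborel"
      by (rule \<mu>.borel_measurable_lebesgue_integral)
    then show ?thesis by (simp add: transfer_def[abs_def])
  qed
  have P01: "0 \<le> ?P x" "?P x \<le> 1" for x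
    using f01 secint[of x] \<mu>.integral_le_const[of "\<lambda>A. f (A *v x)" 1]
    by (auto simp: transfer_def)
  have jensen: "(?P x)\<^sup>2 \<le> (\<integral>A. (f (A *v x))\<^sup>2 \<partial>\<mu>)" for x
  proof -
    have "0 \<le> (\<integral>A. (f (A *v x) - ?P x)\<^sup>2 \<partial>\<mu>)" by simp
    also have "\<dots> = (\<integral>A. (f (A *v x))\<^sup>2 - 2 * ?P x * f (A *v x) + (?P x)\<^sup>2 \<partial>\<mu>)"
      by (intro Bochner_Integration.integral_cong) (auto simp: power2_eq_square algebra_simps)
    also have "\<dots> = (\<integral>A. (f (A *v x))\<^sup>2 \<partial>\<mu>) - 2 * ?P x * (\<integral>A. f (A *v x) \<partial>\<mu>) + (?P x)\<^sup>2"
      using secint secint2 by (simp add: \<mu>.prob_space)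
    also have "(\<integral>A. f (A *v x) \<partial>\<mu>) = ?P x" by (simp add: transfer_def)
    finally show ?thesis by (simp add: power2_eq_square)
  qed
  have sq: "integrable lborel (\<lambda>x. (f (A *v x))\<^sup>2)" "(\<integral>x. (f (A *v x))\<^sup>2 \<partial>lborel) = (\<integral>x. (f x)\<^sup>2 \<partial>lborel)"
    if "A \<in> SL" for A
    using SL_substitution[OF that f2m] f2 by auto
  have int2: "integrable (\<mu> \<Otimes>\<^sub>M lborel) (\<lambda>(A, x). (f (A *v x))\<^sup>2)"
  proof (rule Fubini_integrable[OF am2])
    have "(\<integral>x. norm (case (A, x) of (A, x) \<Rightarrow> (f (A *v x))\<^sup>2) \<partial>lborel) = (\<integral>x. (f x)\<^sup>2 \<partial>lborel)"
      if "A \<in> space \<mu>" for A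
      using sq(2)[of A] that by (simp add: sp)
    note cong = Bochner_Integration.integrable_cong[OF refl this]
    show "integrable \<mu> (\<lambda>A. \<integral>x. norm (case (A, x) of (A, x) \<Rightarrow> (f (A *v x))\<^sup>2) \<partial>lborel)"
      by (subst cong) simp_all
  qed (use sq in \<open>auto simp: sp\<close>)
  have fub: "(\<integral>x. (\<integral>A. (f (A *v x))\<^sup>2 \<partial>\<mu>) \<partial>lborel) = (\<integral>x. (f x)\<^sup>2 \<partial>lborel)"
  proof -
    have "(\<integral>x. (\<integral>A. (f (A *v x))\<^sup>2 \<partial>\<mu>) \<partial>lborel) = (\<integral>A. (\<integral>x. (f (A *v x))\<^sup>2 \<partial>lborel) \<partial>\<mu>)"
      by (rule Fubini_integral[OF int2])
    also have "\<dots> = (\<integral>A. (\<integral>x. (f x)\<^sup>2 \<partial>lborel) \<partial>\<mu>)"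
      by (rule Bochner_Integration.integral_cong[OF refl]) (simp add: sp sq)
    finally show ?thesis by (simp add: \<mu>.prob_space)
  qed
  have majorant: "integrable lborel (\<lambda>x. \<integral>A. (f (A *v x))\<^sup>2 \<partial>\<mu>)"
    using integrable_snd[OF int2] by simp
  have P2: "integrable lborel (\<lambda>x. (?P x)\<^sup>2)"
    using jensen by (intro Bochner_Integration.integrable_bound[OF majorant]) (auto intro: order_trans[OF _ abs_ge_self])
  then show "profile (transfer \<mu> f)"
    using Pm P01 by (simp add: profile_def)
  have "(\<integral>x. (?P x)\<^sup>2 \<partial>lborel) \<le> (\<integral>x. (\<integral>A. (f (A *v x))\<^sup>2 \<partial>\<mu>) \<partial>lborel)"
    by (intro integral_mono P2 majorant jensen)
  then show "(\<integral>x. (?P x)\<^sup>2 \<partial>lborel) \<le> (\<integral>x. (f x)\<^sup>2 \<partial>lborel)"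
    by (simp add: fub)
  have P2': "integrable (\<mu> \<Otimes>\<^sub>M lborel) (\<lambda>(A, x). (?P x)\<^sup>2)"
    using P2 by (intro Fubini_integrable) (auto simp: \<mu>.prob_space)
  have ov: "integrable (\<mu> \<Otimes>\<^sub>M lborel) (\<lambda>(A, x). f (A *v x) * ?P x)"
  proof (rule Bochner_Integration.integrable_bound)
    show "integrable (\<mu> \<Otimes>\<^sub>M lborel) (\<lambda>p. (case p of (A, x) \<Rightarrow> (f (A *v x))\<^sup>2) + (case p of (A, x) \<Rightarrow> (?P x)\<^sup>2))"
      by (intro Bochner_Integration.integrable_add int2 P2')
    show "(\<lambda>(A, x). f (A *v x) * ?P x) \<in> borel_measurable (\<mu> \<Otimes>\<^sub>M lborel)"
      using am by (simp add: case_prod_beta') measurable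
    show "AE p in \<mu> \<Otimes>\<^sub>M lborel. norm (case p of (A, x) \<Rightarrow> f (A *v x) * ?P x) \<le>
        norm ((case p of (A, x) \<Rightarrow> (f (A *v x))\<^sup>2) + (case p of (A, x) \<Rightarrow> (?P x)\<^sup>2))"
      by (intro AE_I2) (auto split: prod.split simp: abs_mult_le_sum_squares)
  qed
  show "integrable \<mu> (\<lambda>A. \<integral>x. f (A *v x) * ?P x \<partial>lborel)"
    using integrable_fst[OF ov] by simp
  have "(\<integral>A. (\<integral>x. f (A *v x) * ?P x \<partial>lborel) \<partial>\<mu>) = (\<integral>x. (\<integral>A. f (A *v x) * ?P x \<partial>\<mu>) \<partial>lborel)"
    using Fubini_integral[OF ov] by simp
  also have "\<dots> = (\<integral>x. (?P x)\<^sup>2 \<partial>lborel)"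
    by (simp add: transfer_def power2_eq_square)
  finally show "(\<integral>A. (\<integral>x. f (A *v x) * ?P x \<partial>lborel) \<partial>\<mu>) = (\<integral>x. (?P x)\<^sup>2 \<partial>lborel)" .
qed

text \<open>
  Let \<open>I\<close> be the average overlap of the normalized functions \<open>f\<close> and \<open>transfer \<mu> f\<close>. It equals the
  ratio of the norms of \<open>transfer \<mu> f\<close> and \<open>f\<close>, so bounding it by \<open>\<rho>\<close> is the claim. If it were close to
  one, then every discrepancy of the two associated functionals would be small, against separation.
\<close>

proposition transfer_contracts:
  fixes \<mu> :: "(real^'n^'n) measure"
  assumes \<mu>: "\<mu> \<in> borel_probs (top_of_set SL)" and f: "profile f"
    and sep: "\<And>L\<^sub>1 L\<^sub>2. L\<^sub>1 \<in> states usphere \<Longrightarrow> L\<^sub>2 \<in> states usphere \<Longrightarrow> separated N c \<mu> L\<^sub>1 L\<^sub>2"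
    and N: "0 < N" and c: "0 < c" and \<rho>: "1 - c\<^sup>2 / (8 * N\<^sup>2) \<le> \<rho>" "0 \<le> \<rho>"
  shows "(\<integral>x. (transfer \<mu> f x)\<^sup>2 \<partial>lborel) \<le> \<rho>\<^sup>2 * (\<integral>x. (f x)\<^sup>2 \<partial>lborel)"
proof -
  interpret prob_space \<mu> using \<mu> by (simp add: borel_probs_def)
  have sp: "space \<mu> = SL" using space_borel_probs[OF \<mu>] by simp
  let ?P = "transfer \<mu> f"
  define a where "a = (\<integral>x. (f x)\<^sup>2 \<partial>lborel)"
  define b where "b = (\<integral>x. (?P x)\<^sup>2 \<partial>lborel)"
  note P = transfer_props[OF \<mu> f]
  have a0: "0 \<le> a" by (simp add: a_def)
  show ?thesis
  proof (cases "b = 0")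
    case True
    then show ?thesis using a0 by (simp add: b_def[symmetric] a_def[symmetric])
  next
    case False
    moreover have "0 \<le> b" by (simp add: b_def)
    ultimately have b: "0 < b" by simp
    have a: "0 < a" using b P(4) by (simp add: a_def b_def)
    define f' where "f' x = f x / sqrt a" for x
    define g' where "g' x = ?P x / sqrt b" for x
    have fm: "f \<in> borel_measurable borel" "integrable lborel (\<lambda>x. (f x)\<^sup>2)"
      and Pm: "?P \<in> borel_measurable borel" "integrable lborel (\<lambda>x. (?P x)\<^sup>2)"
      using f P(1) by (auto simp: profile_def)
    have sqf: "(f' x)\<^sup>2 = (f x)\<^sup>2 / a" and sqg: "(g' x)\<^sup>2 = (?P x)\<^sup>2 / b" for x
      using a b by (simp_all add: f'_def g'_def power_divide)
    have f': "f' \<in> borel_measurable borel" "integrable lborel (\<lambda>x. (f' x)\<^sup>2)" "(\<integral>x. (f' x)\<^sup>2 \<partial>lborel) = 1"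
      using fm a unfolding f'_def[abs_def] sqf by (auto simp: power_divide a_def[symmetric])
    have g': "g' \<in> borel_measurable borel" "integrable lborel (\<lambda>x. (g' x)\<^sup>2)" "(\<integral>x. (g' x)\<^sup>2 \<partial>lborel) = 1"
      using Pm b unfolding g'_def[abs_def] sqg by (auto simp: power_divide b_def[symmetric])
    define ov where "ov A = (\<integral>x. f' (A *v x) * g' x \<partial>lborel)" for A
    have ov: "ov A = (\<integral>x. f (A *v x) * ?P x \<partial>lborel) / sqrt (a * b)" for A
      by (simp add: ov_def f'_def g'_def real_sqrt_mult)
    have ov_int: "integrable \<mu> ov"
      unfolding ov[abs_def] using P(3) by simp
    define I where "I = (\<integral>A. ov A \<partial>\<mu>)"
    have "I = b / sqrt (a * b)"
      unfolding I_def ov using P(2) by (simp add: b_def)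
    also have "\<dots> = (sqrt b * sqrt b) / (sqrt a * sqrt b)"
      using b by (simp add: real_sqrt_mult)
    also have "\<dots> = sqrt b / sqrt a"
      using b by (intro mult_divide_mult_cancel_right) simp
    finally have I: "I = sqrt (b / a)"
      by (simp add: real_sqrt_divide)
    \<comment> \<open>This choice makes the second error term \<open>N * (2 * \<eta>)\<close> equal to
      \<open>c / 2\<close>.\<close>
    define \<eta> where "\<eta> = c / (4 * N)"
    have \<eta>: "0 < \<eta>" using c N by (simp add: \<eta>_def)
    have st: "density_state g' \<in> states usphere" "density_state f' \<in> states usphere"
      using density_state_in_states f' g' by blast+
    obtain h where h: "unit_test h" "c < discrepancy N \<mu> (density_state g') (density_state f') h"
      using sep[OF st] by (auto simp: separated_def)
    have "discrepancy N \<mu> (density_state g') (density_state f') h \<le> (\<integral>A. N * ((1 - ov A) / \<eta> + 2 * \<eta>) \<partial>\<mu>)"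
      unfolding discrepancy_def
    proof (rule integral_mono)
      show "integrable \<mu> (\<lambda>A. cutoff N A * gap_density (density_state g') (density_state f') h A)"
        using N by (intro cutoff_gap_density(3) h st \<mu>) simp
      show "integrable \<mu> (\<lambda>A. N * ((1 - ov A) / \<eta> + 2 * \<eta>))"
        using ov_int by simp
      fix A assume "A \<in> space \<mu>"
      then have A: "A \<in> SL" by (simp add: sp)
      show "cutoff N A * gap_density (density_state g') (density_state f') h A \<le> N * ((1 - ov A) / \<eta> + 2 * \<eta>)"
        using gap_density_le_overlap[OF f' g' h(1) A \<eta>] cutoff_bounds[of N A] N gap_density_bounds(1)[OF h(1) st A]
        by (intro mult_mono) (auto simp: ov_def)
    qed
    also have "\<dots> = N * ((1 - I) / \<eta> + 2 * \<eta>)"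
      using ov_int by (simp add: I_def prob_space)
    finally have "c < N * ((1 - I) / \<eta> + 2 * \<eta>)" using h(2) by simp
    also have "\<dots> = 4 * N\<^sup>2 * (1 - I) / c + c / 2"
      using c N by (simp add: \<eta>_def field_simps power2_eq_square)
    finally have "c / 2 < 4 * N\<^sup>2 * (1 - I) / c" by simp
    then have "c\<^sup>2 / (8 * N\<^sup>2) < 1 - I"
      using c N by (simp add: field_simps power2_eq_square)
    then have "I \<le> \<rho>" using \<rho> by simp
    then have "I\<^sup>2 \<le> \<rho>\<^sup>2"
      using a b by (intro power_mono) (auto simp: I)
    moreover have "I\<^sup>2 = b / a" using a b by (simp add: I)
    ultimately have "b \<le> \<rho>\<^sup>2 * a" using a by (simp add: field_simps)
    then show ?thesis by (simp add: a_def b_def)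
  qed
qed

section \<open>Operator norm and the unit ball\<close>

lemma op_norm_bound: "norm (A *v x) \<le> op_norm A * norm x"
  unfolding op_norm_def by (rule onorm[OF matrix_vector_mul_bounded_linear])

lemma op_norm_nonneg: "0 \<le> op_norm A"
  unfolding op_norm_def by (rule onorm_pos_le[OF matrix_vector_mul_bounded_linear])

lemma op_norm_mult: "op_norm (A ** B) \<le> op_norm A * op_norm B"
proof -
  have "(\<lambda>v. (A ** B) *v v) = (\<lambda>v. A *v v) \<circ> (\<lambda>v. B *v v)"
    by (simp add: fun_eq_iff matrix_vector_mul_assoc)
  then show ?thesis
    unfolding op_norm_def by (simp add: onorm_compose matrix_vector_mul_bounded_linear)
qed

lemma continuous_on_op_norm: "continuous_on S (op_norm :: real^'n^'n \<Rightarrow> real)"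
  unfolding continuous_on_def
proof
  fix A :: "real^'n^'n"
  have diff: "op_norm C \<le> op_norm D + op_norm (C - D)" for C D :: "real^'n^'n"
  proof -
    have "(\<lambda>v. C *v v) = (\<lambda>v. D *v v + (C - D) *v v)"
      by (simp add: fun_eq_iff matrix_vector_mult_diff_rdistrib)
    then show ?thesis
      unfolding op_norm_def
      using onorm_triangle[OF matrix_vector_mul_bounded_linear matrix_vector_mul_bounded_linear, of D "C - D"] by simp
  qed
  have small: "op_norm C \<le> (\<Sum>i\<in>UNIV. \<Sum>j\<in>UNIV. \<bar>C $ i $ j\<bar>)" for C :: "real^'n^'n"
    unfolding op_norm_def by (rule onorm_le_matrix_component_sum)
  let ?s = "\<lambda>B. \<Sum>i\<in>UNIV. \<Sum>j\<in>UNIV. \<bar>(B - A) $ i $ j\<bar>"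
  have bound: "norm (op_norm B - op_norm A) \<le> ?s B" for B
  proof -
    have "op_norm B - op_norm A \<le> ?s B"
      using diff[of B A] small[of "B - A"] by linarith
    moreover have "op_norm A - op_norm B \<le> (\<Sum>i\<in>UNIV. \<Sum>j\<in>UNIV. \<bar>(A - B) $ i $ j\<bar>)"
      using diff[of A B] small[of "A - B"] by linarith
    moreover have "(\<Sum>i\<in>UNIV. \<Sum>j\<in>UNIV. \<bar>(A - B) $ i $ j\<bar>) = ?s B"
      by (simp add: abs_minus_commute)
    ultimately show ?thesis by simp
  qed
  have "(?s \<longlongrightarrow> ?s A) (at A within S)"
    by (intro tendsto_intros)
  then have lim: "(?s \<longlongrightarrow> 0) (at A within S)" by simp
  have "((\<lambda>B. op_norm B - op_norm A) \<longlongrightarrow> 0) (at A within S)"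
    by (intro Lim_null_comparison[OF always_eventually lim] allI bound)
  then show "(op_norm \<longlongrightarrow> op_norm A) (at A within S)"
    by (simp add: Lim_null[of op_norm])
qed

abbreviation ball_profile :: "real^'n \<Rightarrow> real" where
  "ball_profile \<equiv> indicator (cball 0 1)"

lemma ball_profile_measurable [measurable]: "ball_profile \<in> borel_measurable (borel :: (real^'n) measure)"
  by (intro borel_measurable_indicator) simp

lemma cball_indicator_integrable:
  "integrable lborel (indicator (cball c r) :: real^'n \<Rightarrow> real)"
  by (intro integrable_real_indicator emeasure_lborel_cball_finite) simp

lemma ball_profile_square: "(ball_profile x)\<^sup>2 = ball_profile x"
  by (simp add: indicator_def)

lemma ball_profile: "profile ball_profile"
  unfolding profile_def ball_profile_square
  by (intro conjI allI ball_profile_measurable cball_indicator_integrable) (auto simp: indicator_def)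

lemma measure_cball_scale:
  "0 \<le> r \<Longrightarrow> measure lborel (cball (0 :: real^'n) r) = r ^ CARD('n) * unit_ball_vol (real CARD('n))"
  using content_cball[of r "0 :: real^'n"] by (simp add: measure_completion mult.commute)

lemma measure_unit_ball: "measure lborel (cball (0 :: real^'n) 1) = unit_ball_vol (real CARD('n))"
  using measure_cball_scale[of 1, where 'n = 'n] by simp

text \<open>
  Otherwise the unit ball would be mapped into a ball of smaller volume.
\<close>

lemma op_norm_ge_1:
  fixes A :: "real^'n^'n"
  assumes A: "A \<in> SL"
  shows "1 \<le> op_norm A"
proof (rule ccontr)
  let ?d = "CARD('n)"
  assume "\<not> 1 \<le> op_norm A"
  then have lt: "op_norm A < 1" by simp
  have "unit_ball_vol (real CARD('n)) = (\<integral>x. indicator (cball (0 :: real^'n) 1) x \<partial>lborel)"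
    by (simp add: measure_unit_ball)
  also have "\<dots> \<le> (\<integral>x. indicator (cball (0 :: real^'n) (op_norm A)) (A *v x) \<partial>lborel)"
  proof (rule integral_mono)
    show "integrable lborel (\<lambda>x. indicator (cball (0 :: real^'n) (op_norm A)) (A *v x) :: real)"
      by (intro SL_substitution(2)[OF A] cball_indicator_integrable borel_measurable_indicator) simp
    fix x :: "real^'n"
    have "norm (A *v x) \<le> op_norm A" if "norm x \<le> 1"
      using op_norm_bound[of A x] mult_left_mono[OF that op_norm_nonneg[of A]] by simp
    then show "indicator (cball 0 1) x \<le> (indicator (cball 0 (op_norm A)) (A *v x) :: real)"
      by (auto simp: indicator_def)
  qed (rule cball_indicator_integrable)
  also have "\<dots> = measure lborel (cball (0 :: real^'n) (op_norm A))"
    using SL_substitution(1)[OF A, of "indicator (cball 0 (op_norm A))"]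
    by (simp add: borel_measurable_indicator)
  also have "\<dots> = op_norm A ^ ?d * unit_ball_vol (real CARD('n))"
    by (rule measure_cball_scale[OF op_norm_nonneg])
  finally have "1 \<le> op_norm A ^ ?d"
    using unit_ball_vol_pos[of "real CARD('n)"] by simp
  moreover have "op_norm A ^ ?d < 1"
    using lt op_norm_nonneg[of A] by (simp add: power_less_one_iff)
  ultimately show False by simp
qed

text \<open>
  A vector of norm at most \<open>1 / \<parallel>A\<parallel>\<close> lies in the unit ball and is mapped into it. The exponential is
  \<open>\<parallel>A\<parallel>\<close> to the power \<open>- d\<close>, in the form in which the logarithm will be estimated.
\<close>

lemma ball_overlap_lower_bound:
  fixes A :: "real^'n^'n"
  assumes A: "A \<in> SL"
  shows "unit_ball_vol (real CARD('n)) * exp (- real CARD('n) * ln (op_norm A))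
    \<le> (\<integral>x. ball_profile x * ball_profile (A *v x) \<partial>lborel)"
proof -
  let ?r = "1 / op_norm A"
  have r: "0 < op_norm A" using op_norm_ge_1[OF A] by simp
  have "exp (- real CARD('n) * ln (op_norm A)) = ?r ^ CARD('n)"
    using r by (simp add: exp_minus exp_of_nat_mult power_divide divide_inverse power_inverse)
  then have "unit_ball_vol (real CARD('n)) * exp (- real CARD('n) * ln (op_norm A)) = measure lborel (cball (0 :: real^'n) ?r)"
    using r by (simp add: measure_cball_scale)
  also have "\<dots> = (\<integral>x. indicator (cball (0 :: real^'n) ?r) x \<partial>lborel)"
    by simp
  also have "\<dots> \<le> (\<integral>x. ball_profile x * ball_profile (A *v x) \<partial>lborel)"
  proof (rule integral_mono)
    have m: "(\<lambda>x :: real^'n. ball_profile x * ball_profile (A *v x)) \<in> borel_measurable borel"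
      by (intro borel_measurable_times ball_profile_measurable
          measurable_compose[OF borel_measurable_matrix_vector ball_profile_measurable])
    show "integrable lborel (\<lambda>x :: real^'n. ball_profile x * ball_profile (A *v x))"
      using m by (intro Bochner_Integration.integrable_bound[OF cball_indicator_integrable[of 0 1]])
        (auto simp: indicator_def)
    fix x :: "real^'n"
    have "norm (A *v x) \<le> 1 \<and> norm x \<le> 1" if x: "norm x \<le> ?r"
    proof
      have "norm (A *v x) \<le> op_norm A * ?r"
        using op_norm_bound[of A x] mult_left_mono[OF x op_norm_nonneg[of A]] by simp
      then show "norm (A *v x) \<le> 1" using r by simp
      have "?r \<le> 1" using op_norm_ge_1[OF A] by simp
      then show "norm x \<le> 1" using x by linarith
    qed
    then show "indicator (cball 0 ?r) x \<le> (ball_profile x * ball_profile (A *v x) :: real)"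
      by (auto simp: indicator_def)
  qed (rule cball_indicator_integrable)
  finally show ?thesis .
qed

section \<open>Random products\<close>

lemma mat_product_cong: "(\<And>i. i \<in> {1..n} \<Longrightarrow> A i = B i) \<Longrightarrow> mat_product A n = mat_product B n"
  by (induction n) auto

lemma mat_product_SL: "(\<And>i. i \<in> {1..n} \<Longrightarrow> A i \<in> SL) \<Longrightarrow> mat_product A n \<in> SL"
  by (induction n) (auto simp: SL_def det_mul)

lemma ln_op_norm_mat_product:
  "(\<And>i. i \<in> {1..n} \<Longrightarrow> A i \<in> SL) \<Longrightarrow> ln (op_norm (mat_product A n)) \<le> (\<Sum>i\<in>{1..n}. ln (op_norm (A i)))"
proof (induction n)
  case 0
  then show ?case by (simp add: op_norm_def onorm_id)
next
  case (Suc n)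
  have *: "A (Suc n) \<in> SL" "mat_product A n \<in> SL" "mat_product A (Suc n) \<in> SL"
    using Suc.prems by (auto intro!: mat_product_SL simp del: mat_product.simps)
  have ge: "0 < op_norm (A (Suc n))" "0 < op_norm (mat_product A n)" "0 < op_norm (mat_product A (Suc n))"
    using *[THEN op_norm_ge_1] by linarith+
  have "ln (op_norm (mat_product A (Suc n))) \<le> ln (op_norm (A (Suc n)) * op_norm (mat_product A n))"
    using op_norm_mult[of "A (Suc n)" "mat_product A n"] ge by (intro ln_mono) auto
  also have "\<dots> = ln (op_norm (A (Suc n))) + ln (op_norm (mat_product A n))"
    using ge by (simp add: ln_mult)
  finally show ?case using Suc by (simp del: mat_product.simps)
qed

lemma mat_product_measurable:
  fixes \<mu> :: "nat \<Rightarrow> (real^'n^'n) measure"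
  assumes \<mu>: "\<And>i. \<mu> i \<in> borel_probs (top_of_set SL)"
  shows "n \<le> m \<Longrightarrow> (\<lambda>A. mat_product A n) \<in> (\<Pi>\<^sub>M i\<in>{1..m}. \<mu> i) \<rightarrow>\<^sub>M borel"
proof (induction n)
  case (Suc n)
  have "continuous_on UNIV (\<lambda>p :: (real^'n^'n) \<times> (real^'n^'n). fst p ** snd p)"
    unfolding matrix_matrix_mult_def
    by (intro continuous_on_vec_lambda continuous_intros continuous_on_component)
  then have 1: "(\<lambda>p :: (real^'n^'n) \<times> (real^'n^'n). fst p ** snd p) \<in> borel \<Otimes>\<^sub>M borel \<rightarrow>\<^sub>M borel"
    unfolding borel_prod by (rule borel_measurable_continuous_onI)
  have "(\<lambda>A. A (Suc n)) \<in> (\<Pi>\<^sub>M i\<in>{1..m}. \<mu> i) \<rightarrow>\<^sub>M \<mu> (Suc n)"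
    using Suc.prems by (intro measurable_component_singleton) auto
  from measurable_compose[OF this matrix_id_measurable[OF \<mu>]]
  have 2: "(\<lambda>A. (A (Suc n), mat_product A n)) \<in> (\<Pi>\<^sub>M i\<in>{1..m}. \<mu> i) \<rightarrow>\<^sub>M borel \<Otimes>\<^sub>M borel"
    using Suc by (intro measurable_Pair) auto
  show ?case using measurable_compose[OF 2 1] by simp
qed simp

text \<open>
  The last factor of the product acts last on the vector, so it is the first to be averaged out.
\<close>

primrec averaged :: "(nat \<Rightarrow> (real^'n^'n) measure) \<Rightarrow> nat \<Rightarrow> (real^'n \<Rightarrow> real) \<Rightarrow> real^'n \<Rightarrow> real" where
  "averaged \<mu> 0 f = f"
| "averaged \<mu> (Suc n) f = averaged \<mu> n (transfer (\<mu> (Suc n)) f)"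

lemma averaged_profile:
  assumes "\<And>i. \<mu> i \<in> borel_probs (top_of_set SL)"
  shows "profile f \<Longrightarrow> profile (averaged \<mu> n f)"
  by (induction n arbitrary: f) (auto intro: transfer_props(1) assms)

lemma averaged_contracts:
  assumes \<mu>: "\<And>i. \<mu> i \<in> borel_probs (top_of_set SL)"
    and con: "\<And>i f. profile f \<Longrightarrow> (\<integral>x. (transfer (\<mu> i) f x)\<^sup>2 \<partial>lborel) \<le> \<rho>\<^sup>2 * (\<integral>x. (f x)\<^sup>2 \<partial>lborel)"
  shows "profile f \<Longrightarrow> (\<integral>x. (averaged \<mu> n f x)\<^sup>2 \<partial>lborel) \<le> (\<rho> ^ n)\<^sup>2 * (\<integral>x. (f x)\<^sup>2 \<partial>lborel)"
proof (induction n arbitrary: f)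
  case (Suc n)
  have "(\<integral>x. (averaged \<mu> (Suc n) f x)\<^sup>2 \<partial>lborel) \<le> (\<rho> ^ n)\<^sup>2 * (\<integral>x. (transfer (\<mu> (Suc n)) f x)\<^sup>2 \<partial>lborel)"
    using Suc.IH[OF transfer_props(1)[OF \<mu> Suc.prems]] by simp
  also have "\<dots> \<le> (\<rho> ^ n)\<^sup>2 * (\<rho>\<^sup>2 * (\<integral>x. (f x)\<^sup>2 \<partial>lborel))"
    using con[OF Suc.prems] by (intro mult_left_mono) auto
  finally show ?case by (simp add: power_mult_distrib mult_ac)
qed simp

lemma expectation_mat_product:
  fixes \<mu> :: "nat \<Rightarrow> (real^'n^'n) measure"
  assumes \<mu>: "\<And>i. \<mu> i \<in> borel_probs (top_of_set SL)"
  shows "profile f \<Longrightarrow> (\<integral>A. f (mat_product A n *v x) \<partial>(\<Pi>\<^sub>M i\<in>{1..n}. \<mu> i)) = averaged \<mu> n f x"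
proof (induction n arbitrary: f)
  case 0
  interpret prob_space "\<Pi>\<^sub>M i\<in>{1..0::nat}. \<mu> i"
    using \<mu> by (intro prob_space_PiM) (auto simp: borel_probs_def)
  show ?case by (simp add: prob_space[simplified])
next
  case (Suc n)
  have ps: "prob_space (\<mu> i)" for i using \<mu> by (simp add: borel_probs_def)
  interpret product_sigma_finite \<mu>
    using ps by (simp add: product_sigma_finite_def prob_space_imp_sigma_finite)
  interpret S: prob_space "\<Pi>\<^sub>M i\<in>{1..Suc n}. \<mu> i"
    by (intro prob_space_PiM ps)
  have ins: "insert (Suc n) {1..n} = {1..Suc n}" by auto
  have f: "f \<in> borel_measurable borel" "\<And>x. 0 \<le> f x" "\<And>x. f x \<le> 1"
    using Suc.prems by (auto simp: profile_def)
  note am = action_measurable[OF mat_product_measurable[OF \<mu> order_refl, of "Suc n"] f(1)]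
  have "(\<lambda>A. f (mat_product A (Suc n) *v x)) \<in> borel_measurable (\<Pi>\<^sub>M i\<in>{1..Suc n}. \<mu> i)"
    using measurable_compose[OF measurable_Pair2'[of x lborel] am] by (simp del: mat_product.simps)
  then have int: "integrable (\<Pi>\<^sub>M i\<in>insert (Suc n) {1..n}. \<mu> i) (\<lambda>A. f (mat_product A (Suc n) *v x))"
    unfolding ins using f by (intro S.integrable_const_bound[of _ 1]) auto
  have "(\<integral>A. f (mat_product A (Suc n) *v x) \<partial>(\<Pi>\<^sub>M i\<in>{1..Suc n}. \<mu> i)) =
      (\<integral>A. (\<integral>B. f (mat_product (A(Suc n := B)) (Suc n) *v x) \<partial>\<mu> (Suc n)) \<partial>(\<Pi>\<^sub>M i\<in>{1..n}. \<mu> i))"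
    using product_integral_insert[OF _ _ int] unfolding ins by simp
  also have "\<dots> = (\<integral>A. transfer (\<mu> (Suc n)) f (mat_product A n *v x) \<partial>(\<Pi>\<^sub>M i\<in>{1..n}. \<mu> i))"
  proof -
    have "mat_product (A(Suc n := B)) n = mat_product A n" for A and B :: "real^'n^'n"
      by (rule mat_product_cong) auto
    then show ?thesis
      by (simp add: transfer_def matrix_vector_mul_assoc)
  qed
  also have "\<dots> = averaged \<mu> (Suc n) f x"
    using Suc.IH[OF transfer_props(1)[OF \<mu> Suc.prems]] by simp
  finally show ?case .
qed

text \<open>
  The expected overlap of the unit ball with its preimage is the inner product of the indicator of
  the ball with its \<open>n\<close>-fold average, whose norm has decayed by the factor \<open>\<rho> ^ n\<close>.
\<close>

lemma expected_inverse_norm: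
  fixes \<mu> :: "nat \<Rightarrow> (real^'n^'n) measure" and n :: nat
  assumes \<mu>: "\<And>i. \<mu> i \<in> borel_probs (top_of_set SL)"
    and con: "\<And>i f. profile f \<Longrightarrow> (\<integral>x. (transfer (\<mu> i) f x)\<^sup>2 \<partial>lborel) \<le> \<rho>\<^sup>2 * (\<integral>x. (f x)\<^sup>2 \<partial>lborel)"
    and \<rho>: "0 < \<rho>"
  defines "p \<equiv> \<lambda>A :: nat \<Rightarrow> real^'n^'n. exp (- real CARD('n) * ln (op_norm (mat_product A n)))"
  shows "integrable (\<Pi>\<^sub>M i\<in>{1..n}. \<mu> i) p" and "(\<integral>A. p A \<partial>(\<Pi>\<^sub>M i\<in>{1..n}. \<mu> i)) \<le> \<rho> ^ n"
proof -
  let ?M = "\<Pi>\<^sub>M i\<in>{1..n}. \<mu> i"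
  let ?T = "\<lambda>A :: nat \<Rightarrow> real^'n^'n. mat_product A n"
  let ?b = "ball_profile :: real^'n \<Rightarrow> real"
  let ?V = "unit_ball_vol (real CARD('n))"
  have V: "0 < ?V" by simp
  interpret prob_space ?M
    using \<mu> by (intro prob_space_PiM) (auto simp: borel_probs_def)
  interpret pair_sigma_finite ?M "lborel :: (real^'n) measure" ..
  have SL: "?T A \<in> SL" if "A \<in> space ?M" for A
  proof (rule mat_product_SL)
    fix i assume "i \<in> {1..n}"
    then have "A i \<in> space (\<mu> i)" using that by (auto simp: space_PiM)
    then show "A i \<in> SL" using space_borel_probs[OF \<mu>[of i]] by simp
  qed
  have Tm: "?T \<in> ?M \<rightarrow>\<^sub>M borel" by (rule mat_product_measurable[where \<mu> = \<mu>, OF \<mu> order_refl])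
  have norm_m: "(\<lambda>A. op_norm (?T A)) \<in> borel_measurable ?M"
    by (rule measurable_compose[OF Tm borel_measurable_continuous_onI[OF continuous_on_op_norm]])
  have p_m: "p \<in> borel_measurable ?M"
    unfolding p_def using norm_m by measurable
  have p_le: "\<bar>p A\<bar> \<le> 1" if "A \<in> space ?M" for A
    using op_norm_ge_1[OF SL[OF that]] by (simp add: p_def)
  show p_int: "integrable ?M p"
    using p_m p_le by (intro integrable_const_bound[of _ 1]) auto
  note h = averaged_profile[where \<mu> = \<mu> and n = n, OF \<mu> ball_profile]
  let ?h = "averaged \<mu> n ?b"
  have am: "(\<lambda>(A, x). ?b (?T A *v x)) \<in> borel_measurable (?M \<Otimes>\<^sub>M lborel)"
    by (rule action_measurable[OF Tm ball_profile_measurable])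
  have b_m: "(\<lambda>(A, x). ?b x) \<in> borel_measurable (?M \<Otimes>\<^sub>M lborel)"
    using measurable_compose[OF measurable_snd, of ?b lborel borel ?M] ball_profile_measurable
    by (simp add: case_prod_beta')
  have b_int: "integrable (?M \<Otimes>\<^sub>M lborel) (\<lambda>(A, x). ?b x)"
  proof (rule Fubini_integrable[OF b_m])
    show "integrable ?M (\<lambda>A. \<integral>x. norm (case (A, x) of (A, x) \<Rightarrow> ?b x) \<partial>lborel)"
      unfolding prod.case by (rule integrable_const)
  qed (simp add: cball_indicator_integrable)
  have ov: "integrable (?M \<Otimes>\<^sub>M lborel) (\<lambda>(A, x). ?b x * ?b (?T A *v x))"
  proof (rule Bochner_Integration.integrable_bound[OF b_int])
    show "(\<lambda>(A, x). ?b x * ?b (?T A *v x)) \<in> borel_measurable (?M \<Otimes>\<^sub>M lborel)"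
      using borel_measurable_times[OF b_m am] by (simp add: case_prod_beta')
  qed (auto simp: indicator_def)
  have "?V * (\<integral>A. p A \<partial>?M) = (\<integral>A. ?V * p A \<partial>?M)" by simp
  also have "\<dots> \<le> (\<integral>A. (\<integral>x. ?b x * ?b (?T A *v x) \<partial>lborel) \<partial>?M)"
  proof (rule integral_mono)
    show "integrable ?M (\<lambda>A. \<integral>x. ?b x * ?b (?T A *v x) \<partial>lborel)"
      using integrable_fst[OF ov] by simp
    show "?V * p A \<le> (\<integral>x. ?b x * ?b (?T A *v x) \<partial>lborel)" if "A \<in> space ?M" for A
      unfolding p_def by (rule ball_overlap_lower_bound[OF SL[OF that]])
  qed (use p_int in simp)
  also have "\<dots> = (\<integral>x. (\<integral>A. ?b x * ?b (?T A *v x) \<partial>?M) \<partial>lborel)"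
    by (rule Fubini_integral[OF ov, symmetric])
  also have "\<dots> = (\<integral>x. ?b x * ?h x \<partial>lborel)"
    by (simp only: integral_mult_right_zero expectation_mat_product[where \<mu> = \<mu>, OF \<mu> ball_profile])
  also have "\<dots> \<le> (\<integral>x. \<rho> ^ n / 2 * ?b x + (?h x)\<^sup>2 / (2 * \<rho> ^ n) \<partial>lborel)"
  proof (rule integral_mono)
    have hm: "?h \<in> borel_measurable borel" "\<And>x. 0 \<le> ?h x \<and> ?h x \<le> 1" and h2: "integrable lborel (\<lambda>x. (?h x)\<^sup>2)"
      using h by (auto simp: profile_def)
    show "integrable lborel (\<lambda>x. ?b x * ?h x)"
    proof (rule Bochner_Integration.integrable_bound[OF cball_indicator_integrable[of 0 1]])
      show "(\<lambda>x. ?b x * ?h x) \<in> borel_measurable lborel"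
        using borel_measurable_times[OF ball_profile_measurable hm(1)] by simp
    qed (use hm(2) in \<open>auto simp: indicator_def\<close>)
    show "integrable lborel (\<lambda>x. \<rho> ^ n / 2 * ?b x + (?h x)\<^sup>2 / (2 * \<rho> ^ n))"
      using cball_indicator_integrable[of "0 :: real^'n" 1] h2 by (intro Bochner_Integration.integrable_add integrable_mult_right integrable_divide)
    fix x
    have t: "0 < \<rho> ^ n" using \<rho> by simp
    \<comment> \<open>The Cauchy-Schwarz inequality in pointwise form, with the weights that are optimal for
      the expected decay.\<close>
    have "0 \<le> (\<rho> ^ n * ?b x - ?h x)\<^sup>2" by simp
    then have "2 * \<rho> ^ n * (?b x * ?h x) \<le> (\<rho> ^ n)\<^sup>2 * (?b x)\<^sup>2 + (?h x)\<^sup>2"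
      by (simp add: power2_eq_square algebra_simps)
    then have "2 * \<rho> ^ n * (?b x * ?h x) \<le> (\<rho> ^ n)\<^sup>2 * ?b x + (?h x)\<^sup>2"
      unfolding ball_profile_square .
    then have "?b x * ?h x \<le> ((\<rho> ^ n)\<^sup>2 * ?b x + (?h x)\<^sup>2) / (2 * \<rho> ^ n)"
      using t by (simp add: pos_le_divide_eq mult.commute)
    also have "\<dots> = \<rho> ^ n / 2 * ?b x + (?h x)\<^sup>2 / (2 * \<rho> ^ n)"
      using t by (simp add: add_divide_distrib power2_eq_square)
    finally show "?b x * ?h x \<le> \<rho> ^ n / 2 * ?b x + (?h x)\<^sup>2 / (2 * \<rho> ^ n)" .
  qed
  also have "\<dots> = \<rho> ^ n / 2 * ?V + (\<integral>x. (?h x)\<^sup>2 \<partial>lborel) / (2 * \<rho> ^ n)"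
  proof -
    have h2: "integrable lborel (\<lambda>x. (?h x)\<^sup>2)" using h by (simp add: profile_def)
    have "(\<integral>x. ?b x \<partial>lborel) = ?V" by (simp add: measure_unit_ball)
    then show ?thesis
      using cball_indicator_integrable[of "0 :: real^'n" 1] h2
      by (subst Bochner_Integration.integral_add) (simp_all only: integral_mult_right_zero integral_divide_zero integrable_mult_right integrable_divide)
  qed
  also have "\<dots> \<le> \<rho> ^ n / 2 * ?V + (\<rho> ^ n)\<^sup>2 * ?V / (2 * \<rho> ^ n)"
  proof -
    have "(\<integral>x. (?h x)\<^sup>2 \<partial>lborel) \<le> (\<rho> ^ n)\<^sup>2 * (\<integral>x. (?b x)\<^sup>2 \<partial>lborel)"
      by (rule averaged_contracts[where \<mu> = \<mu>, OF \<mu> con ball_profile])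
    also have "(\<integral>x. (?b x)\<^sup>2 \<partial>lborel) = ?V"
      unfolding ball_profile_square by (simp add: measure_unit_ball)
    finally show ?thesis using \<rho> by (intro add_left_mono divide_right_mono) auto
  qed
  also have "\<dots> = ?V * \<rho> ^ n"
    using \<rho> by (simp add: power2_eq_square)
  finally show "(\<integral>A. p A \<partial>?M) \<le> \<rho> ^ n"
    using V by simp
qed

text \<open>
  Jensen's inequality for the exponential, in the form of its tangent line at \<open>c = n * ln \<rho>\<close>:
  \<open>exp y \<ge> exp c * (1 + y - c)\<close>. Integrability of the logarithm comes from submultiplicativity.
\<close>

proposition expected_log_norm_lower_bound:
  fixes \<mu> :: "nat \<Rightarrow> (real^'n^'n) measure"
  assumes \<mu>: "\<And>i. \<mu> i \<in> borel_probs (top_of_set SL)"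
    and con: "\<And>i f. profile f \<Longrightarrow> (\<integral>x. (transfer (\<mu> i) f x)\<^sup>2 \<partial>lborel) \<le> \<rho>\<^sup>2 * (\<integral>x. (f x)\<^sup>2 \<partial>lborel)"
    and \<rho>: "0 < \<rho>"
    and log_moment: "\<And>i. integrable (\<mu> i) (\<lambda>A. ln (op_norm A))"
  shows "real n * (- ln \<rho> / real CARD('n)) \<le> expected_log_norm \<mu> n"
proof -
  let ?M = "\<Pi>\<^sub>M i\<in>{1..n}. \<mu> i"
  let ?l = "\<lambda>A :: nat \<Rightarrow> real^'n^'n. ln (op_norm (mat_product A n))"
  let ?d = "real CARD('n)"
  have ps: "prob_space (\<mu> i)" for i using \<mu> by (simp add: borel_probs_def)
  interpret prob_space ?M by (intro prob_space_PiM ps)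
  have SLi: "A i \<in> SL" if "A \<in> space ?M" "i \<in> {1..n}" for A i
  proof -
    have "A i \<in> space (\<mu> i)" using that by (auto simp: space_PiM)
    then show ?thesis using space_borel_probs[OF \<mu>[of i]] by simp
  qed
  have l_int: "integrable ?M ?l"
  proof (rule Bochner_Integration.integrable_bound)
    have "integrable ?M (\<lambda>A. ln (op_norm (A i)))" if i: "i \<in> {1..n}" for i
    proof (rule integrable_distr[of "\<lambda>A. A i" ?M "\<mu> i"])
      show "(\<lambda>A. A i) \<in> ?M \<rightarrow>\<^sub>M \<mu> i" using i by (rule measurable_component_singleton)
      show "integrable (distr ?M (\<mu> i) (\<lambda>A. A i)) (\<lambda>A. ln (op_norm A))"
        using log_moment[of i] distr_PiM_component[of "{1..n}" \<mu> i] ps i by simp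
    qed
    then show "integrable ?M (\<lambda>A. \<Sum>i\<in>{1..n}. ln (op_norm (A i)))"
      by (rule Bochner_Integration.integrable_sum)
    have "(\<lambda>A. op_norm (mat_product A n)) \<in> borel_measurable ?M"
      by (rule measurable_compose[OF mat_product_measurable[where \<mu> = \<mu>, OF \<mu> order_refl]
            borel_measurable_continuous_onI[OF continuous_on_op_norm]])
    then show "?l \<in> borel_measurable ?M" by measurable
    show "AE A in ?M. norm (?l A) \<le> norm (\<Sum>i\<in>{1..n}. ln (op_norm (A i)))"
    proof (rule AE_I2)
      fix A assume A: "A \<in> space ?M"
      have "0 \<le> ?l A"
        using op_norm_ge_1[OF mat_product_SL[of n A]] SLi[OF A] by simp
      moreover have "?l A \<le> (\<Sum>i\<in>{1..n}. ln (op_norm (A i)))"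
        using SLi[OF A] by (rule ln_op_norm_mat_product)
      ultimately show "norm (?l A) \<le> norm (\<Sum>i\<in>{1..n}. ln (op_norm (A i)))" by simp
    qed
  qed
  define c where "c = real n * ln \<rho>"
  have ec: "exp c = \<rho> ^ n"
    using \<rho> by (simp add: c_def exp_of_nat_mult)
  note p = expected_inverse_norm[where \<mu> = \<mu> and n = n, OF \<mu> con \<rho>]
  have "exp c * (1 - ?d * expected_log_norm \<mu> n - c) = (\<integral>A. exp c * (1 + (- ?d * ?l A) - c) \<partial>?M)"
  proof -
    have i: "integrable ?M (\<lambda>A. - ?d * ?l A)" by (intro integrable_mult_right l_int)
    have "(\<integral>A. 1 + (- ?d * ?l A) - c \<partial>?M) = 1 + (- ?d * expected_log_norm \<mu> n) - c"
      unfolding Bochner_Integration.integral_diff[OF Bochner_Integration.integrable_add[OF integrable_const i] integrable_const]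
        Bochner_Integration.integral_add[OF integrable_const i] integral_mult_right_zero expected_log_norm_def
      by (simp add: prob_space del: One_nat_def)
    then show ?thesis by simp
  qed
  also have "\<dots> \<le> (\<integral>A. exp (- ?d * ?l A) \<partial>?M)"
  proof (rule integral_mono)
    show "exp c * (1 + (- ?d * ?l A) - c) \<le> exp (- ?d * ?l A)" for A
    proof -
      have "1 + (- ?d * ?l A) - c \<le> exp (- ?d * ?l A - c)"
        using exp_ge_add_one_self[of "- ?d * ?l A - c"] by linarith
      then have "exp c * (1 + (- ?d * ?l A) - c) \<le> exp c * exp (- ?d * ?l A - c)"
        by (rule mult_left_mono) simp
      then show ?thesis by (simp add: exp_add[symmetric])
    qed
    show "integrable ?M (\<lambda>A. exp c * (1 + (- ?d * ?l A) - c))"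
      by (intro integrable_mult_right Bochner_Integration.integrable_diff
          Bochner_Integration.integrable_add integrable_const l_int)
  qed (rule p(1))
  also have "\<dots> \<le> exp c * 1" using p(2) ec by simp
  finally have "1 - ?d * expected_log_norm \<mu> n - c \<le> 1" by simp
  then show ?thesis by (simp add: c_def field_simps)
qed

theorem theorem1p5:
  fixes K :: "(real^'n^'n) measure set"
  assumes dim: "CARD('n) \<ge> 2"
    and compact: "compactin (weak_topology (top_of_set SL)) K"
    and log_moment: "\<forall>\<mu>\<in>K. integrable \<mu> (\<lambda>A. ln (op_norm A))"
    and measures_condition: "\<forall>\<mu>\<in>K. \<not> (\<exists>\<nu>\<^sub>1 \<in> borel_probs proj_space. \<exists>\<nu>\<^sub>2 \<in> borel_probs proj_space.
           AE A in \<mu>. distr \<nu>\<^sub>1 (borel_of proj_space) (proj_map A) = \<nu>\<^sub>2)"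
  shows "\<exists>lam>0. (\<forall>n \<mu>. (\<forall>i\<in>{1..n}. \<mu> i \<in> K) \<longrightarrow> expected_log_norm \<mu> n \<ge> real n * lam) \<and>
                (\<forall>\<mu>. (\<forall>i\<ge>1. \<mu> i \<in> K) \<longrightarrow>
                   liminf (\<lambda>n. ereal (1 / real n * expected_log_norm \<mu> n)) \<ge> ereal lam)"
proof -
  have K: "\<mu> \<in> borel_probs (top_of_set SL)" if "\<mu> \<in> K" for \<mu>
    using that compactin_subset_topspace[OF compact] by (auto simp: topspace_weak_topology)
  obtain N c where N: "0 < N" and c: "0 < c"
    and sep: "\<And>\<mu> L\<^sub>1 L\<^sub>2. \<mu> \<in> K \<Longrightarrow> L\<^sub>1 \<in> states usphere \<Longrightarrow> L\<^sub>2 \<in> states usphere \<Longrightarrow> separated N c \<mu> L\<^sub>1 L\<^sub>2"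
    by (rule uniform_separation[OF compact measures_condition]) blast
  \<comment> \<open>The maximum with one half keeps \<open>\<rho>\<close> positive, as its logarithm is
    taken.\<close>
  define \<rho> where "\<rho> = max (1/2) (1 - c\<^sup>2 / (8 * N\<^sup>2))"
  have \<rho>: "0 < \<rho>" "\<rho> < 1" "1 - c\<^sup>2 / (8 * N\<^sup>2) \<le> \<rho>"
    using N c by (auto simp: \<rho>_def)
  define lam where "lam = - ln \<rho> / real CARD('n)"
  have lam: "0 < lam" unfolding lam_def using \<rho> by (intro divide_pos_pos) auto
  have con: "(\<integral>x. (transfer \<mu> f x)\<^sup>2 \<partial>lborel) \<le> \<rho>\<^sup>2 * (\<integral>x. (f x)\<^sup>2 \<partial>lborel)" if "\<mu> \<in> K" "profile f" for \<mu> f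
    using transfer_contracts[OF K[OF that(1)] that(2) sep[OF that(1)] N c \<rho>(3)] \<rho>(1) by simp
  have bound: "real n * lam \<le> expected_log_norm \<mu> n" if \<mu>: "\<forall>i\<in>{1..n}. \<mu> i \<in> K" for n \<mu>
  proof (cases "n = 0")
    case True
    then show ?thesis by (simp add: expected_log_norm_def op_norm_def onorm_id)
  next
    case False
    \<comment> \<open>Outside the first \<open>n\<close> indices nothing is known about \<open>\<mu>\<close>;
      those entries do not enter the product measure.\<close>
    define \<mu>' where "\<mu>' i = (if i \<in> {1..n} then \<mu> i else \<mu> 1)" for i
    have \<mu>': "\<mu>' i \<in> K" for i using \<mu> False by (auto simp: \<mu>'_def)
    have "real n * lam \<le> expected_log_norm \<mu>' n"
      unfolding lam_def
      by (rule expected_log_norm_lower_bound) (use \<mu>' K con log_moment \<rho> in auto)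
    also have "expected_log_norm \<mu>' n = expected_log_norm \<mu> n"
    proof -
      have "(\<Pi>\<^sub>M i\<in>{1..n}. \<mu>' i) = (\<Pi>\<^sub>M i\<in>{1..n}. \<mu> i)"
        by (rule PiM_cong) (auto simp: \<mu>'_def)
      then show ?thesis by (simp add: expected_log_norm_def)
    qed
    finally show ?thesis .
  qed
  have "ereal lam \<le> liminf (\<lambda>n. ereal (1 / real n * expected_log_norm \<mu> n))" if \<mu>: "\<forall>i\<ge>1. \<mu> i \<in> K" for \<mu>
  proof (rule Liminf_bounded)
    show "\<forall>\<^sub>F n in sequentially. ereal lam \<le> ereal (1 / real n * expected_log_norm \<mu> n)"
      using eventually_gt_at_top[of 0]
    proof eventually_elim
      case (elim n)
      have "real n * lam \<le> expected_log_norm \<mu> n" using \<mu> by (intro bound) auto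
      then show ?case using elim by (simp add: field_simps)
    qed
  qed
  then show ?thesis using lam bound by blast
qed

end
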